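(* Let $k$ be an $F$-finite field of prime characteristic $p$, let $R=k[x,y]$, let $\kappa$ be the Cartier operator generating $\operatorname{Hom}_R(F_*R,R)$ as a right $R$-module, and set $$\mathcal{D}=\bigoplus_{e\geq 0}\kappa^e\mathfrak{a}_e,\qquad \mathfrak{a}_0=R,\qquad \mathfrak{a}_e=(x^2,\,xy^{ep^e})\ \text{ for } e\geq 1.$$ Then $\mathcal{D}$ is a Cartier subalgebra of $R$ which is not gauge bounded, but $\operatorname{cx}(\mathcal{D})=1$. In particular, a Cartier algebra of finite complexity need not be gauge bounded.
   Context: **Cartier algebras.** For an $F$-finite noetherian commutative ring $R$ of characteristic $p$ (i.e. $F_*R$ is a finite $R$-module, $F$ the Frobenius), the total Cartier algebra is $\mathcal{C}^R=\bigoplus_{e\geq 0}\mathcal{C}^R_e$ with $\mathcal{C}^R_e=\operatorname{Hom}_R(F^e_*R,R)$. It is a graded non-commutative ring with product $\varphi\cdot\psi=\varphi\circ F^a_*\psi$ for $\varphi\in\mathcal{C}^R_a$, $\psi\in\mathcal{C}^R_b$. Each $\mathcal{C}^R_e$ is an $R$-bimodule: $(r\cdot\varphi)(s)=r\varphi(s)$ and $(\varphi\cdot r)(s)=\varphi(rs)$, so $\varphi\cdot r^{p^e}=r\cdot\varphi$. A Cartier subalgebra of $R$ is a graded subring $\mathcal{D}\subseteq\mathcal{C}^R$ with $\mathcal{D}_0=R$ and $\mathcal{D}_e\neq 0$ for some $e>0$. Write $\mathcal{D}_+=\bigoplus_{e\geq 1}\mathcal{D}_e$. **Cartier operator.** Fix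 an isomorphism $k\to\operatorname{Hom}_k(F_*k,k)$ (right $k$-module structure on the target) and let $\lambda\colon F_*k\to k$ be the corresponding map (the image of $1$); if $k$ is perfect one may take $\lambda$ to be the $p$-th root map. For $R=k[x_1,\ldots,x_n]$ (here $n=2$, with variables $x,y$), $\kappa^e\colon F^e_*R\to R$ is the $R$-linear map (i.e. additive with $\kappa^e(r^{p^e}s)=r\kappa^e(s)$) such that, for $c\in k$ and $0\leq\alpha_i\leq p^e-1$, $\kappa^e(cx^\alpha)=\lambda^e(c)$ if all $\alpha_i=p^e-1$, and $\kappa^e(cx^\alpha)=0$ otherwise; $\kappa^e$ is the $e$-fold power of $\kappa=\kappa^1$ in $\mathcal{C}^R$ and generates $\mathcal{C}^R_e$ as a right $R$-module. For an ideal $\mathfrak{a}$, $\kappa^e\mathfrak{a}=\{r\mapsto\kappa^e(fr): f\in\mathfrak{a}\}\subseteq\mathcal{C}^R_e$. **Complexity.** For $e\geq -1$ let $G_e=G_e(\mathcal{D})$ be the subring of $\mathcal{D}$ generated by the elements of degree $\leq e$ (with $G_{-1}=\mathcal{D}_0$), and let $k_e$ be the minimal number of homogeneous generators of $G_e$ as a ring over $\mathcal{D}_0=R$. The complexity of $\mathcal{D}$ is $\operatorname{cx}(\mathcal{D})=\inf\{m\in\mathbb{R}_{>0}: k_e-k_{e-1}=\mathcal{O}(m^e)\}$ (as $e\to\infty$), provided the $k_e$ are finite, with $\inf\varnothing=\infty$. **Gauge boundedness.** For $d\geq 0$ let $R_d$ be the $k$-subspace of $R=k[x,y]$ spanned by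 the monomials $x^{\alpha_1}y^{\alpha_2}$ with $0\leq\alpha_1,\alpha_2\leq d$, and $R_d=0$ for $d<0$. The gauge $\delta\colon R\to\mathbb{N}\cup\{-\infty\}$ is defined by $\delta(0)=-\infty$ and $\delta(r)=d$ if $r\neq 0$ and $r\in R_d\smallsetminus R_{d-1}$. $\mathcal{D}$ is gauge bounded if there are a set $\{\psi_i\mid\psi_i\in\mathcal{D}_{e_i},\ e_i\geq 1\}$ generating $\mathcal{D}_+$ as a right $R$-module and a constant $K$ such that $\delta(\psi_i(r))\leq\frac{\delta(r)}{p^{e_i}}+K$ for all $i$ and all $r\in R$. *)

theory Defs
  imports
    "HOL-Algebra.Generated_Rings"
    "HOL-Library.Extended_Nat"
    "HOL-Library.Extended_Real"
    "HOL-Library.Landau_Symbols"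
    "HOL-Computational_Algebra.Polynomial"
begin

hide_const (open) UnivPoly.monom UnivPoly.coeff

section \<open>Cartier algebras\<close>

text \<open>
  The module \<open>F\<^sup>e\<^sub>*R\<close> is \<open>R\<close> itself as an additive group, with \<open>r\<close> acting as multiplication by
  \<open>r ^ (p ^ e)\<close>.
\<close>

definition F_finite :: "nat \<Rightarrow> 'r::comm_ring_1 itself \<Rightarrow> bool" where
  "F_finite p _ \<longleftrightarrow>
     (\<exists>B. finite B \<and> Modules.module.span (\<lambda>(r::'r) s. r ^ p * s) B = UNIV)"

definition frob_hom :: "nat \<Rightarrow> nat \<Rightarrow> ('r::comm_ring_1 \<Rightarrow> 'r) set" where
  "frob_hom p e =
     {\<phi>. (\<forall>r s. \<phi> (r + s) = \<phi> r + \<phi> s) \<and> (\<forall>r s. \<phi> (r ^ (p ^ e) * s) = r * \<phi> s)}"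

text \<open>
  An element of the direct sum of the \<open>frob_hom p e\<close> is the family of its homogeneous components.
  The Frobenius pushforward does not change underlying functions, so the product of homogeneous
  elements is composition.
\<close>

definition cartier_algebra :: "nat \<Rightarrow> (nat \<Rightarrow> 'r::comm_ring_1 \<Rightarrow> 'r) ring" where
  "cartier_algebra p =
     \<lparr> carrier = {\<phi>. (\<forall>e. \<phi> e \<in> frob_hom p e) \<and> finite {e. \<phi> e \<noteq> (\<lambda>_. 0)}},
       monoid.mult = (\<lambda>\<phi> \<psi> e s. \<Sum>a\<le>e. \<phi> a (\<psi> (e - a) s)),
       one = (\<lambda>e s. if e = 0 then s else 0),
       zero = (\<lambda>e s. 0),
       add = (\<lambda>\<phi> \<psi> e s. \<phi> e s + \<psi> e s) \<rparr>"

definition component :: "(nat \<Rightarrow> 'r::comm_ring_1 \<Rightarrow> 'r) \<Rightarrow> nat \<Rightarrow> nat \<Rightarrow> 'r \<Rightarrow> 'r" where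
  "component \<phi> d = (\<lambda>e s. if e = d then \<phi> e s else 0)"

definition degree_part ::
    "(nat \<Rightarrow> 'r::comm_ring_1 \<Rightarrow> 'r) set \<Rightarrow> nat \<Rightarrow> (nat \<Rightarrow> 'r \<Rightarrow> 'r) set" where
  "degree_part D d = {\<phi> \<in> D. \<forall>e. e \<noteq> d \<longrightarrow> \<phi> e = (\<lambda>_. 0)}"

definition scalar :: "'r::comm_ring_1 \<Rightarrow> nat \<Rightarrow> 'r \<Rightarrow> 'r" where
  "scalar r = (\<lambda>e s. if e = 0 then r * s else 0)"

definition cartier_subalgebra :: "nat \<Rightarrow> (nat \<Rightarrow> 'r::comm_ring_1 \<Rightarrow> 'r) set \<Rightarrow> bool" where
  "cartier_subalgebra p D \<longleftrightarrow>
     subring D (cartier_algebra p) \<and>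
     (\<forall>\<phi>\<in>D. \<forall>d. component \<phi> d \<in> D) \<and>
     degree_part D 0 = range scalar \<and>
     (\<exists>e>0. degree_part D e \<noteq> {\<zero>\<^bsub>cartier_algebra p\<^esub>})"


section \<open>Complexity\<close>

definition gen_subring ::
    "nat \<Rightarrow> (nat \<Rightarrow> 'r::comm_ring_1 \<Rightarrow> 'r) set \<Rightarrow> int \<Rightarrow> (nat \<Rightarrow> 'r \<Rightarrow> 'r) set" where
  "gen_subring p D e =
     (if e < 0 then degree_part D 0
      else generate_ring (cartier_algebra p) {\<phi> \<in> D. \<forall>d. int d > e \<longrightarrow> \<phi> d = (\<lambda>_. 0)})"

definition min_gens :: "nat \<Rightarrow> (nat \<Rightarrow> 'r::comm_ring_1 \<Rightarrow> 'r) set \<Rightarrow> int \<Rightarrow> enat" where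
  "min_gens p D e =
     Inf {enat (card S) | S. finite S \<and> S \<subseteq> (\<Union>d. degree_part (gen_subring p D e) d) \<and>
       generate_ring (cartier_algebra p) (degree_part D 0 \<union> S) = gen_subring p D e}"

text \<open>The complexity is also set to be infinite if some \<open>min_gens p D e\<close> is.\<close>

definition complexity :: "nat \<Rightarrow> (nat \<Rightarrow> 'r::comm_ring_1 \<Rightarrow> 'r) set \<Rightarrow> ereal" where
  "complexity p D =
     (if \<forall>e. min_gens p D e \<noteq> \<infinity>
      then Inf {ereal m | m. m > 0 \<and>
             (\<lambda>e::nat. real (the_enat (min_gens p D (int e)))
                     - real (the_enat (min_gens p D (int e - 1)))) \<in> O(\<lambda>e. m ^ e)}
      else \<infinity>)"


section \<open>The polynomial ring in two variables\<close>

text \<open>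
  The ring \<open>k[x, y]\<close> is represented as \<open>k[x][y]\<close>: the inner variable is \<open>x\<close>, the outer one \<open>y\<close>.
\<close>

definition mono2 :: "'k::field \<Rightarrow> nat \<Rightarrow> nat \<Rightarrow> 'k poly poly" where
  "mono2 c i j = Polynomial.monom (Polynomial.monom c i) j"

definition varx :: "'k::field poly poly" where "varx = mono2 1 1 0"

definition vary :: "'k::field poly poly" where "vary = mono2 1 0 1"

definition gauge_space :: "int \<Rightarrow> 'k::field poly poly set" where
  "gauge_space d =
     Modules.module.span (\<lambda>c f. mono2 c 0 0 * f) {mono2 1 i j | i j. int i \<le> d \<and> int j \<le> d}"

definition gauge :: "'k::field poly poly \<Rightarrow> ereal" where
  "gauge r =
     (if r = 0 then -\<infinity>
      else ereal (real (THE d. r \<in> gauge_space (int d) - gauge_space (int d - 1))))"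

definition right_span ::
    "(nat \<Rightarrow> 'r::comm_ring_1 \<Rightarrow> 'r) set \<Rightarrow> (nat \<Rightarrow> 'r \<Rightarrow> 'r) set" where
  "right_span \<Psi> = {\<lambda>e s. \<Sum>\<psi>\<in>T. \<psi> e (c \<psi> * s) | T c. finite T \<and> T \<subseteq> \<Psi>}"

definition gauge_bounded :: "nat \<Rightarrow> (nat \<Rightarrow> 'k::field poly poly \<Rightarrow> 'k poly poly) set \<Rightarrow> bool" where
  "gauge_bounded p D \<longleftrightarrow>
     (\<exists>\<Psi> (K::real).
        right_span \<Psi> = {\<phi> \<in> D. \<phi> 0 = (\<lambda>_. 0)} \<and>
        (\<forall>\<psi>\<in>\<Psi>. \<exists>e\<ge>1. \<psi> \<in> degree_part D e \<and>
           (\<forall>r. gauge (\<psi> e r) \<le> gauge r / ereal (real (p ^ e)) + ereal K)))"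


section \<open>The Cartier operator\<close>

definition cartier_generator :: "nat \<Rightarrow> ('k::field \<Rightarrow> 'k) \<Rightarrow> bool" where
  "cartier_generator p lam \<longleftrightarrow>
     (\<exists>\<Phi>. bij_betw \<Phi> UNIV (frob_hom p 1) \<and>
          (\<forall>a b. \<Phi> (a + b) = (\<lambda>s. \<Phi> a s + \<Phi> b s)) \<and>
          (\<forall>a b. \<Phi> (a * b) = (\<lambda>s. \<Phi> a (b * s))) \<and>
          lam = \<Phi> 1)"

definition is_cartier_operator ::
    "nat \<Rightarrow> ('k::field \<Rightarrow> 'k) \<Rightarrow> nat \<Rightarrow> ('k poly poly \<Rightarrow> 'k poly poly) \<Rightarrow> bool" where
  "is_cartier_operator p lam e \<phi> \<longleftrightarrow>
     \<phi> \<in> frob_hom p e \<and>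
     (\<forall>c i j. i \<le> p ^ e - 1 \<and> j \<le> p ^ e - 1 \<longrightarrow>
        \<phi> (mono2 c i j) =
          (if i = p ^ e - 1 \<and> j = p ^ e - 1 then mono2 ((lam ^^ e) c) 0 0 else 0))"

definition kappa :: "nat \<Rightarrow> ('k::field \<Rightarrow> 'k) \<Rightarrow> nat \<Rightarrow> 'k poly poly \<Rightarrow> 'k poly poly" where
  "kappa p lam e = (THE \<phi>. is_cartier_operator p lam e \<phi>)"

definition ideal_sum_algebra ::
    "nat \<Rightarrow> ('k::field \<Rightarrow> 'k) \<Rightarrow> (nat \<Rightarrow> 'k poly poly set) \<Rightarrow>
     (nat \<Rightarrow> 'k poly poly \<Rightarrow> 'k poly poly) set" where
  "ideal_sum_algebra p lam a =
     {\<phi> \<in> carrier (cartier_algebra p). \<forall>e. \<phi> e \<in> {\<lambda>r. kappa p lam e (f * r) | f. f \<in> a e}}"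

definition example_ideal :: "nat \<Rightarrow> nat \<Rightarrow> 'k::field poly poly set" where
  "example_ideal p e =
     (if e = 0 then UNIV else Modules.module.span (*) {varx ^ 2, varx * vary ^ (e * p ^ e)})"

section \<open>Well-definedness of the notions above\<close>

lemma frob_hom_zero: "\<phi> \<in> frob_hom p e \<Longrightarrow> \<phi> 0 = 0"
  unfolding frob_hom_def by (metis (mono_tags, lifting) add_cancel_right_right mem_Collect_eq)

lemma frob_hom_add: "\<phi> \<in> frob_hom p e \<Longrightarrow> \<phi> (r + s) = \<phi> r + \<phi> s"
  by (simp add: frob_hom_def)

lemma frob_hom_scale: "\<phi> \<in> frob_hom p e \<Longrightarrow> \<phi> (r ^ (p ^ e) * s) = r * \<phi> s"
  by (simp add: frob_hom_def)

lemma frob_hom_sum: "\<phi> \<in> frob_hom p e \<Longrightarrow> \<phi> (sum f A) = (\<Sum>x\<in>A. \<phi> (f x))"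
  by (induction A rule: infinite_finite_induct) (auto simp: frob_hom_zero frob_hom_add)

lemma frob_hom_comp:
  assumes "\<phi> \<in> frob_hom p a" "\<psi> \<in> frob_hom p b"
  shows "(\<lambda>s. \<phi> (\<psi> s)) \<in> frob_hom p (a + b)"
proof -
  have "\<phi> (\<psi> (r ^ (p ^ (a + b)) * s)) = r * \<phi> (\<psi> s)" for r s
  proof -
    have "r ^ (p ^ (a + b)) = (r ^ (p ^ a)) ^ (p ^ b)" by (simp add: power_add power_mult)
    then show ?thesis using assms by (simp add: frob_hom_scale)
  qed
  then show ?thesis using assms by (simp add: frob_hom_def)
qed

lemma frob_hom_closed_sum:
  assumes "\<And>x. x \<in> A \<Longrightarrow> \<phi> x \<in> frob_hom p e"
  shows "(\<lambda>s. \<Sum>x\<in>A. \<phi> x s) \<in> frob_hom p e"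
  using assms by (simp add: frob_hom_def sum.distrib sum_distrib_left)

lemma cartier_algebra_mult_closed:
  assumes "\<phi> \<in> carrier (cartier_algebra p)" "\<psi> \<in> carrier (cartier_algebra p)"
  shows "\<phi> \<otimes>\<^bsub>cartier_algebra p\<^esub> \<psi> \<in> carrier (cartier_algebra p)"
proof -
  let ?X = "{e. \<phi> e \<noteq> (\<lambda>_. 0)}" and ?Y = "{e. \<psi> e \<noteq> (\<lambda>_. 0)}"
  have hom: "\<And>e. \<phi> e \<in> frob_hom p e" "\<And>e. \<psi> e \<in> frob_hom p e"
    and fin: "finite ?X" "finite ?Y"
    using assms by (auto simp: cartier_algebra_def)
  have 1: "(\<lambda>s. \<Sum>a\<le>e. \<phi> a (\<psi> (e - a) s)) \<in> frob_hom p e" for e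
  proof (rule frob_hom_closed_sum)
    fix a assume "a \<in> {..e}"
    then show "(\<lambda>s. \<phi> a (\<psi> (e - a) s)) \<in> frob_hom p e"
      using frob_hom_comp[OF hom(1)[of a] hom(2)[of "e - a"]] by simp
  qed
  have "{e. (\<lambda>s. \<Sum>a\<le>e. \<phi> a (\<psi> (e - a) s)) \<noteq> (\<lambda>_. 0)} \<subseteq> (\<lambda>(a, b). a + b) ` (?X \<times> ?Y)"
  proof
    fix e assume "e \<in> {e. (\<lambda>s. \<Sum>a\<le>e. \<phi> a (\<psi> (e - a) s)) \<noteq> (\<lambda>_. 0)}"
    then obtain s where "(\<Sum>a\<le>e. \<phi> a (\<psi> (e - a) s)) \<noteq> 0" by auto
    then obtain a where a: "a \<le> e" "\<phi> a (\<psi> (e - a) s) \<noteq> 0"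
      by (meson sum.neutral atMost_iff)
    then have "a \<in> ?X" "e - a \<in> ?Y" using frob_hom_zero[OF hom(1)[of a]] by auto
    then show "e \<in> (\<lambda>(a, b). a + b) ` (?X \<times> ?Y)" using a(1)
      by (intro image_eqI[of _ _ "(a, e - a)"]) auto
  qed
  then have "finite {e. (\<lambda>s. \<Sum>a\<le>e. \<phi> a (\<psi> (e - a) s)) \<noteq> (\<lambda>_. 0)}"
    by (rule finite_subset) (use fin in auto)
  with 1 show ?thesis by (simp add: cartier_algebra_def)
qed

lemma ring_cartier_algebra: "ring (cartier_algebra p :: (nat \<Rightarrow> 'r::comm_ring_1 \<Rightarrow> 'r) ring)"
proof (rule ringI)
  let ?C = "cartier_algebra p :: (nat \<Rightarrow> 'r \<Rightarrow> 'r) ring"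
  show "abelian_group ?C"
  proof (rule abelian_groupI)
    fix x y assume x: "x \<in> carrier ?C" and y: "y \<in> carrier ?C"
    have "finite {e. (\<lambda>s. x e s + y e s) \<noteq> (\<lambda>_. 0)}"
      by (rule finite_subset[of _ "{e. x e \<noteq> (\<lambda>_. 0)} \<union> {e. y e \<noteq> (\<lambda>_. 0)}"])
         (use x y in \<open>auto simp: cartier_algebra_def\<close>)
    then show "x \<oplus>\<^bsub>?C\<^esub> y \<in> carrier ?C"
      using x y by (auto simp: cartier_algebra_def frob_hom_def algebra_simps)
  next
    fix x assume x: "x \<in> carrier ?C"
    have "(\<lambda>e s. - x e s) \<in> carrier ?C"
    proof -
      have "{e. (\<lambda>s. - x e s) \<noteq> (\<lambda>_. 0)} = {e. x e \<noteq> (\<lambda>_. 0)}" by (auto simp: fun_eq_iff)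
      then show ?thesis using x by (auto simp: cartier_algebra_def frob_hom_def)
    qed
    then show "\<exists>y\<in>carrier ?C. y \<oplus>\<^bsub>?C\<^esub> x = \<zero>\<^bsub>?C\<^esub>"
      by (intro bexI[of _ "\<lambda>e s. - x e s"]) (auto simp: cartier_algebra_def)
  qed (auto simp: cartier_algebra_def frob_hom_def algebra_simps)
  show "monoid ?C"
  proof (rule monoidI)
    show "\<one>\<^bsub>?C\<^esub> \<in> carrier ?C"
    proof -
      have "finite {e::nat. (\<lambda>s::'r. if e = 0 then s else 0) \<noteq> (\<lambda>_. 0)}"
        by (rule finite_subset[of _ "{0}"]) (auto split: if_splits)
      then show ?thesis by (auto simp: cartier_algebra_def frob_hom_def)
    qed
    fix x assume x: "x \<in> carrier ?C"
    then have x0: "x e 0 = 0" for e using frob_hom_zero by (auto simp: cartier_algebra_def)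
    have l: "(\<Sum>a\<le>e. if a = 0 then x (e - a) s else 0) = x e s" for e s
      by (subst sum.delta) auto
    have r: "(\<Sum>a\<le>e. x a (if e - a = 0 then s else 0)) = x e s" for e s
    proof -
      have "(\<Sum>a\<le>e. x a (if e - a = 0 then s else 0)) = (\<Sum>a\<le>e. if a = e then x a s else 0)"
        by (rule sum.cong) (auto simp: x0)
      then show ?thesis by simp
    qed
    show "\<one>\<^bsub>?C\<^esub> \<otimes>\<^bsub>?C\<^esub> x = x" using l by (simp add: cartier_algebra_def fun_eq_iff)
    show "x \<otimes>\<^bsub>?C\<^esub> \<one>\<^bsub>?C\<^esub> = x" using r by (simp add: cartier_algebra_def fun_eq_iff)
  next
    fix x y z assume x: "x \<in> carrier ?C" and y: "y \<in> carrier ?C" and z: "z \<in> carrier ?C"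
    have hom: "x a \<in> frob_hom p a" for a using x by (auto simp: cartier_algebra_def)
    show "x \<otimes>\<^bsub>?C\<^esub> y \<otimes>\<^bsub>?C\<^esub> z = x \<otimes>\<^bsub>?C\<^esub> (y \<otimes>\<^bsub>?C\<^esub> z)"
    proof -
      have key: "(\<Sum>n\<le>e. \<Sum>a\<le>n. x a (y (n - a) (z (e - n) s)))
          = (\<Sum>a\<le>e. x a (\<Sum>b\<le>e - a. y b (z (e - a - b) s)))" for e s
      proof -
      define g where "g = (\<lambda>a b c. x a (y b (z c s)))"
      have "(\<Sum>n\<le>e. \<Sum>a\<le>n. x a (y (n - a) (z (e - n) s))) = (\<Sum>n\<le>e. \<Sum>a\<le>n. g a (n - a) (e - n))"
        by (simp add: g_def)
      also have "\<dots> = (\<Sum>a\<le>e. \<Sum>b\<le>e - a. g a b (e - a - b))"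
        unfolding sum.Sigma[OF finite_atMost ballI[OF finite_atMost]]
        by (rule sum.reindex_bij_witness[where
              j = "\<lambda>(n, a). (a, n - a)" and i = "\<lambda>(a, b). (a + b, a)"]) auto
      finally show ?thesis by (simp add: g_def frob_hom_sum[OF hom])
      qed
      then show ?thesis by (simp add: cartier_algebra_def fun_eq_iff)
    qed
  qed (rule cartier_algebra_mult_closed)
next
  fix x y z :: "nat \<Rightarrow> 'r \<Rightarrow> 'r"
  let ?C = "cartier_algebra p :: (nat \<Rightarrow> 'r \<Rightarrow> 'r) ring"
  assume "x \<in> carrier ?C" "y \<in> carrier ?C" and z: "z \<in> carrier ?C"
  show "(x \<oplus>\<^bsub>?C\<^esub> y) \<otimes>\<^bsub>?C\<^esub> z = x \<otimes>\<^bsub>?C\<^esub> z \<oplus>\<^bsub>?C\<^esub> y \<otimes>\<^bsub>?C\<^esub> z"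
    by (simp add: cartier_algebra_def fun_eq_iff sum.distrib)
  have zh: "z a \<in> frob_hom p a" for a using z by (auto simp: cartier_algebra_def)
  show "z \<otimes>\<^bsub>?C\<^esub> (x \<oplus>\<^bsub>?C\<^esub> y) = z \<otimes>\<^bsub>?C\<^esub> x \<oplus>\<^bsub>?C\<^esub> z \<otimes>\<^bsub>?C\<^esub> y"
    by (simp add: cartier_algebra_def fun_eq_iff sum.distrib frob_hom_add[OF zh])
qed

lemma degree_part_zero_cartier_algebra:
  "degree_part (carrier (cartier_algebra p)) 0 = range (scalar :: 'r::comm_ring_1 \<Rightarrow> _)"
proof
  show "degree_part (carrier (cartier_algebra p)) 0 \<subseteq> range (scalar :: 'r \<Rightarrow> _)"
  proof
    fix \<phi> :: "nat \<Rightarrow> 'r \<Rightarrow> 'r"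
    assume "\<phi> \<in> degree_part (carrier (cartier_algebra p)) 0"
    then have h: "\<phi> 0 \<in> frob_hom p 0" and z: "\<And>e. e \<noteq> 0 \<Longrightarrow> \<phi> e = (\<lambda>_. 0)"
      by (auto simp: degree_part_def cartier_algebra_def)
    have mult: "\<phi> 0 s = \<phi> 0 1 * s" for s
      using frob_hom_scale[OF h, of s 1] by (simp add: mult.commute)
    have "\<phi> e s = scalar (\<phi> 0 1) e s" for e s
    proof (cases "e = 0")
      case True
      then show ?thesis using mult[of s] by (simp only: scalar_def refl if_True)
    next
      case False
      then show ?thesis by (simp add: z scalar_def)
    qed
    then have "\<phi> = scalar (\<phi> 0 1)" by blast
    then show "\<phi> \<in> range scalar" by blast
  qed
  have "finite {e::nat. (\<lambda>s::'r. if e = 0 then r * s else 0) \<noteq> (\<lambda>_. 0)}" for r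
    by (rule finite_subset[of _ "{0}"]) (auto split: if_splits)
  then show "range (scalar :: 'r \<Rightarrow> _) \<subseteq> degree_part (carrier (cartier_algebra p)) 0"
    by (auto simp: degree_part_def cartier_algebra_def scalar_def frob_hom_def algebra_simps)
qed

lemma poly2_induct [case_names mono2 add]:
  fixes f :: "'k::field poly poly"
  assumes mono: "\<And>c i j. P (mono2 c i j)" and add: "\<And>f g. P f \<Longrightarrow> P g \<Longrightarrow> P (f + g)"
  shows "P f"
proof -
  have 0: "P 0" using mono[of 0 0 0] by (simp add: mono2_def)
  have sumP: "P (sum h A)" if "\<And>x. x \<in> A \<Longrightarrow> P (h x)" for h and A :: "nat set"
    using that by (induction A rule: infinite_finite_induct) (auto simp: 0 add)
  have "P (Polynomial.monom g j)" for g j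
  proof -
    have "Polynomial.monom g j =
        (\<Sum>i\<le>degree g. mono2 (Polynomial.coeff g i) i j)"
      by (subst (1) poly_as_sum_of_monoms[of g, symmetric])
         (simp add: mono2_def poly_eq_iff coeff_sum if_distrib cong: if_cong)
    then show ?thesis using sumP[of "{..degree g}"] mono by simp
  qed
  then show ?thesis
    using sumP[of "{..degree f}" "\<lambda>j. Polynomial.monom (Polynomial.coeff f j) j"]
    by (simp add: poly_as_sum_of_monoms)
qed

text \<open>The Cartier operator exists, is unique, and has the expected description on coefficients.\<close>

definition decimate :: "nat \<Rightarrow> ('a::zero \<Rightarrow> 'b::zero) \<Rightarrow> 'a poly \<Rightarrow> 'b poly" where
  "decimate q g f = Abs_poly (\<lambda>j. g (Polynomial.coeff f (j * q + (q - 1))))"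

lemma coeff_decimate:
  assumes "q > 0" "g 0 = 0"
  shows "Polynomial.coeff (decimate q g f) j = g (Polynomial.coeff f (j * q + (q - 1)))"
proof -
  have "Polynomial.coeff f (j * q + (q - 1)) = 0" if "j > degree f" for j
  proof (rule coeff_eq_0)
    have "j * 1 \<le> j * q" using assms(1) by (intro mult_le_mono2) auto
    then show "degree f < j * q + (q - 1)" using that by linarith
  qed
  then have "\<forall>j>degree f. g (Polynomial.coeff f (j * q + (q - 1))) = 0"
    using assms(2) by simp
  then show ?thesis unfolding decimate_def by (subst coeff_Abs_poly) auto
qed

lemma decimate_frob_hom:
  fixes g :: "'a::comm_ring_1 \<Rightarrow> 'a"
  assumes p: "prime p" "CHAR('a) = p" and g: "g \<in> frob_hom p e"
  shows "decimate (p ^ e) g \<in> frob_hom p e"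
proof -
  let ?q = "p ^ e"
  have q: "?q > 0" using p(1) by (simp add: prime_gt_0_nat)
  note g0 = frob_hom_zero[OF g]
  note co = coeff_decimate[where g = g, OF q g0]
  have add: "decimate ?q g (r + s) = decimate ?q g r + decimate ?q g s" for r s
    by (simp add: poly_eq_iff co frob_hom_add[OF g])
  have mono: "decimate ?q g (Polynomial.monom c m ^ ?q * s) = Polynomial.monom c m * decimate ?q g s"
    for c m s
  proof (rule poly_eqI)
    fix j
    have "m * ?q \<le> j * ?q + (?q - 1) \<longleftrightarrow> m \<le> j"
    proof
      assume "m * ?q \<le> j * ?q + (?q - 1)"
      also have "\<dots> < Suc j * ?q" using q by (simp add: less_imp_Suc_add)
      finally have "m * ?q < Suc j * ?q" .
      then show "m \<le> j" using mult_less_cancel2 less_Suc_eq_le by blast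
    next
      assume "m \<le> j"
      then show "m * ?q \<le> j * ?q + (?q - 1)" by (simp add: trans_le_add1)
    qed
    moreover have "j * ?q + (?q - 1) - m * ?q = (j - m) * ?q + (?q - 1)" if "m \<le> j"
      using that by (auto simp: le_iff_add algebra_simps)
    ultimately show "Polynomial.coeff (decimate ?q g (Polynomial.monom c m ^ ?q * s)) j =
        Polynomial.coeff (Polynomial.monom c m * decimate ?q g s) j"
      by (auto simp: co monom_power Polynomial.coeff_monom_mult frob_hom_scale[OF g] g0
          simp flip: One_nat_def)
  qed
  have sc: "decimate ?q g ((\<Sum>i\<in>A. Polynomial.monom (h i) i) ^ ?q * s)
      = (\<Sum>i\<in>A. Polynomial.monom (h i) i) * decimate ?q g s" if "finite A" for A h s
    using that
  proof (induction A)
    case empty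
    have "decimate ?q g 0 = 0" using add[of 0 0] by simp
    moreover have "(0::'a poly) ^ ?q = 0" using q by (rule zero_power)
    ultimately show ?case by simp
  next
    case (insert a A)
    have "(Polynomial.monom (h a) a + (\<Sum>i\<in>A. Polynomial.monom (h i) i)) ^ ?q
        = Polynomial.monom (h a) a ^ ?q + (\<Sum>i\<in>A. Polynomial.monom (h i) i) ^ ?q"
      by (rule freshmans_dream') (use p in simp_all)
    then show ?case using insert by (simp add: distrib_right add mono)
  qed
  have "decimate ?q g (r ^ ?q * s) = r * decimate ?q g s" for r s
    using sc[of "{..degree r}" "Polynomial.coeff r" s] by (simp add: poly_as_sum_of_monoms)
  with add show ?thesis by (simp add: frob_hom_def)
qed

lemma funpow_frob_hom: "lam \<in> frob_hom p 1 \<Longrightarrow> lam ^^ e \<in> frob_hom p e"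
proof (induction e)
  case 0
  then show ?case by (simp add: frob_hom_def)
next
  case (Suc e)
  then show ?case using frob_hom_comp[of lam p 1 "lam ^^ e" e] by (simp add: comp_def)
qed

lemma is_cartier_operator_unique:
  assumes "prime p" and \<phi>: "is_cartier_operator p lam e \<phi>" and \<psi>: "is_cartier_operator p lam e \<psi>"
  shows "\<phi> = \<psi>"
proof
  fix f
  let ?q = "p ^ e"
  have q: "?q > 0" using assms(1) by (simp add: prime_gt_0_nat)
  have h: "\<phi> \<in> frob_hom p e" "\<psi> \<in> frob_hom p e"
    using \<phi> \<psi> by (auto simp: is_cartier_operator_def)
  show "\<phi> f = \<psi> f"
  proof (induction f rule: poly2_induct)
    case (mono2 c i j)
    have le: "n mod ?q \<le> ?q - 1" for n using q mod_less_divisor[of ?q n] by linarith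
    have "mono2 c i j = mono2 1 (i div ?q) (j div ?q) ^ ?q * mono2 c (i mod ?q) (j mod ?q)"
      by (simp add: mono2_def monom_power mult_monom mult.commute)
    moreover have "\<phi> (mono2 c (i mod ?q) (j mod ?q)) = \<psi> (mono2 c (i mod ?q) (j mod ?q))"
      using \<phi> \<psi> le[of i] le[of j] by (simp add: is_cartier_operator_def)
    ultimately show ?case by (simp add: h[THEN frob_hom_scale])
  next
    case (add f g)
    then show ?case by (simp add: h[THEN frob_hom_add])
  qed
qed

lemma is_cartier_operator_decimate:
  fixes lam :: "'k::field \<Rightarrow> 'k"
  assumes p: "prime p" "CHAR('k) = p" and lam: "lam \<in> frob_hom p 1"
  shows "is_cartier_operator p lam e (decimate (p ^ e) (decimate (p ^ e) (lam ^^ e)))"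
proof -
  let ?q = "p ^ e"
  let ?g = "decimate ?q (lam ^^ e)"
  have q: "?q > 0" using p(1) by (simp add: prime_gt_0_nat)
  have l: "lam ^^ e \<in> frob_hom p e" by (rule funpow_frob_hom[OF lam])
  have g: "?g \<in> frob_hom p e" by (rule decimate_frob_hom[OF p l])
  have "decimate ?q ?g \<in> frob_hom p e"
    by (rule decimate_frob_hom[OF p(1) _ g]) (simp add: p(2))
  moreover have "decimate ?q ?g (mono2 c i j) =
      (if i = ?q - 1 \<and> j = ?q - 1 then mono2 ((lam ^^ e) c) 0 0 else 0)"
    if "i \<le> ?q - 1" "j \<le> ?q - 1" for c i j
  proof -
    have eq: "i = n * ?q + (?q - 1) \<longleftrightarrow> n = 0 \<and> i = ?q - 1" if "i \<le> ?q - 1" for i n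
    proof (cases n)
      case (Suc m)
      have "n * ?q + (?q - 1) \<ge> ?q" using Suc by simp
      then show ?thesis using that q Suc by linarith
    qed simp
    show ?thesis
    proof (rule poly_eqI, rule poly_eqI)
      fix m n
      have "Polynomial.coeff (Polynomial.coeff (decimate ?q ?g (mono2 c i j)) m) n =
          (lam ^^ e) (if j = m * ?q + (?q - 1) \<and> i = n * ?q + (?q - 1) then c else 0)"
        by (simp only: coeff_decimate[where g = ?g, OF q frob_hom_zero[OF g]]
              coeff_decimate[where g = "lam ^^ e", OF q frob_hom_zero[OF l]]
              mono2_def Polynomial.coeff_monom if_distrib[of "\<lambda>h. Polynomial.coeff h _"] coeff_0)
           simp
      also have "\<dots> = (lam ^^ e) (if (m = 0 \<and> j = ?q - 1) \<and> n = 0 \<and> i = ?q - 1 then c else 0)"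
        by (simp only: eq[OF that(1)] eq[OF that(2)])
      also have "\<dots> = Polynomial.coeff (Polynomial.coeff
          (if i = ?q - 1 \<and> j = ?q - 1 then mono2 ((lam ^^ e) c) 0 0 else 0) m) n"
        using frob_hom_zero[OF l] by (auto simp: mono2_def)
      finally show "Polynomial.coeff (Polynomial.coeff (decimate ?q ?g (mono2 c i j)) m) n =
        Polynomial.coeff (Polynomial.coeff
          (if i = ?q - 1 \<and> j = ?q - 1 then mono2 ((lam ^^ e) c) 0 0 else 0) m) n" .
    qed
  qed
  ultimately show ?thesis by (simp add: is_cartier_operator_def)
qed

lemma is_cartier_operator_kappa:
  fixes lam :: "'k::field \<Rightarrow> 'k"
  assumes "prime p" "CHAR('k) = p" "lam \<in> frob_hom p 1"
  shows "is_cartier_operator p lam e (kappa p lam e)"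
  unfolding kappa_def
  by (rule theI[where P = "is_cartier_operator p lam e", OF is_cartier_operator_decimate[OF assms]])
     (rule is_cartier_operator_unique[OF assms(1) _ is_cartier_operator_decimate[OF assms]])

lemma coeff_kappa:
  fixes lam :: "'k::field \<Rightarrow> 'k"
  assumes "prime p" "CHAR('k) = p" "lam \<in> frob_hom p 1"
  shows "Polynomial.coeff (Polynomial.coeff (kappa p lam e f) j) i =
    (lam ^^ e) (Polynomial.coeff (Polynomial.coeff f (j * p ^ e + (p ^ e - 1))) (i * p ^ e + (p ^ e - 1)))"
proof -
  have q: "p ^ e > 0" using assms(1) by (simp add: prime_gt_0_nat)
  have l: "lam ^^ e \<in> frob_hom p e" by (rule funpow_frob_hom[OF assms(3)])
  have g: "decimate (p ^ e) (lam ^^ e) \<in> frob_hom p e" by (rule decimate_frob_hom[OF assms(1,2) l])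
  have "kappa p lam e = decimate (p ^ e) (decimate (p ^ e) (lam ^^ e))"
    by (rule is_cartier_operator_unique[OF assms(1) is_cartier_operator_kappa[OF assms]
          is_cartier_operator_decimate[OF assms]])
  then show ?thesis
    by (simp add: coeff_decimate[OF q] frob_hom_zero[OF l] frob_hom_zero[OF g])
qed

lemma kappa_eq_funpow:
  fixes lam :: "'k::field \<Rightarrow> 'k"
  assumes "prime p" "CHAR('k) = p" "lam \<in> frob_hom p 1"
  shows "kappa p lam e = kappa p lam 1 ^^ e"
proof (induction e)
  case 0
  show ?case by (simp add: fun_eq_iff poly_eq_iff coeff_kappa[OF assms])
next
  case (Suc e)
  have p: "p > 0" using assms(1) by (simp add: prime_gt_0_nat)
  have ix: "(n * p + (p - 1)) * p ^ e + (p ^ e - 1) = n * p ^ Suc e + (p ^ Suc e - 1)" for n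
  proof -
    have "(n * p + (p - 1)) * p ^ e + p ^ e = n * p ^ Suc e + p ^ Suc e"
      using p by (cases p) (simp_all add: algebra_simps)
    moreover have "p ^ e > 0" "p ^ Suc e > 0" using p by simp_all
    ultimately show ?thesis by linarith
  qed
  have l1: "lam ^^ 1 = lam" by simp
  have "kappa p lam (Suc e) f = kappa p lam 1 (kappa p lam e f)" for f
    by (rule poly_eqI, rule poly_eqI)
       (simp only: coeff_kappa[OF assms] ix power_one_right funpow.simps l1 comp_def id_def)
  then show ?case using Suc by (simp add: fun_eq_iff)
qed

lemma gauge_space_iff:
  "f \<in> gauge_space d \<longleftrightarrow>
     (\<forall>i j. Polynomial.coeff (Polynomial.coeff f j) i \<noteq> 0 \<longrightarrow> int i \<le> d \<and> int j \<le> d)"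
proof -
  let ?M = "{mono2 1 i j | i j. int i \<le> d \<and> int j \<le> d} :: 'a poly poly set"
  interpret V: Modules.module "\<lambda>(c::'a) (f::'a poly poly). mono2 c 0 0 * f"
    by standard (simp_all add: mono2_def algebra_simps add_monom [symmetric] mult_monom
        flip: one_pCons)
  show ?thesis
  proof
    assume "f \<in> gauge_space d"
    then show "\<forall>i j. Polynomial.coeff (Polynomial.coeff f j) i \<noteq> 0 \<longrightarrow> int i \<le> d \<and> int j \<le> d"
      unfolding gauge_space_def
    proof (induction rule: V.span_induct_alt)
      case (step c x y)
      then obtain a b where x: "x = mono2 1 a b" "int a \<le> d" "int b \<le> d" by auto
      have "mono2 c 0 0 * x = mono2 c a b" by (simp add: x mono2_def mult_monom)
      then show ?case using step.IH x by (fastforce simp: mono2_def split: if_splits)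
    qed simp
  next
    assume h: "\<forall>i j. Polynomial.coeff (Polynomial.coeff f j) i \<noteq> 0 \<longrightarrow> int i \<le> d \<and> int j \<le> d"
    have mono: "mono2 (Polynomial.coeff (Polynomial.coeff f j) i) i j \<in> V.span ?M" for i j
    proof (cases "Polynomial.coeff (Polynomial.coeff f j) i = 0")
      case True
      then show ?thesis using V.span_zero by (simp add: mono2_def)
    next
      case False
      then have "mono2 1 i j \<in> ?M" using h by blast
      from V.span_scale[OF V.span_base[OF this], of "Polynomial.coeff (Polynomial.coeff f j) i"]
      show ?thesis by (simp add: mono2_def mult_monom)
    qed
    have "f = (\<Sum>j\<le>degree f. \<Sum>i\<le>degree (Polynomial.coeff f j).
        mono2 (Polynomial.coeff (Polynomial.coeff f j) i) i j)"
    proof -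
      have "Polynomial.monom g j = (\<Sum>i\<le>degree g. mono2 (Polynomial.coeff g i) i j)"
        for g :: "'a poly" and j
        by (subst (1) poly_as_sum_of_monoms[of g, symmetric])
           (simp add: mono2_def poly_eq_iff coeff_sum if_distrib cong: if_cong)
      then show ?thesis by (metis (mono_tags, lifting) poly_as_sum_of_monoms sum.cong)
    qed
    also have "\<dots> \<in> V.span ?M" by (intro V.span_sum mono)
    finally show "f \<in> gauge_space d" by (simp add: gauge_space_def)
  qed
qed

lemma gauge_unique:
  assumes "r \<noteq> 0"
  shows "\<exists>!d. r \<in> gauge_space (int d) - gauge_space (int d - 1)"
proof -
  have mono: "gauge_space a \<subseteq> gauge_space b" if "a \<le> b" for a b
    using that by (fastforce simp: gauge_space_iff)
  define N where "N = Max (insert (degree r) ((\<lambda>j. degree (Polynomial.coeff r j)) ` {..degree r}))"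
  have "r \<in> gauge_space (int N)"
    unfolding gauge_space_iff
  proof (intro allI impI)
    fix i j assume nz: "Polynomial.coeff (Polynomial.coeff r j) i \<noteq> 0"
    then have "Polynomial.coeff r j \<noteq> 0" by auto
    then have j: "j \<le> degree r" by (rule le_degree)
    have "i \<le> degree (Polynomial.coeff r j)" using nz by (rule le_degree)
    also have "\<dots> \<le> N" unfolding N_def by (rule Max_ge) (use j in auto)
    finally have "i \<le> N" .
    moreover have "degree r \<le> N" unfolding N_def by (rule Max_ge) auto
    ultimately show "int i \<le> int N \<and> int j \<le> int N" using j by simp
  qed
  then obtain d::nat where d: "r \<in> gauge_space (int d)"
      and least: "\<And>d'. d' < d \<Longrightarrow> r \<notin> gauge_space (int d')"
    using exists_least_iff[of "\<lambda>d. r \<in> gauge_space (int d)"] by blast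
  have "r \<notin> gauge_space (int d - 1)"
  proof (cases d)
    case 0
    have "r \<in> gauge_space (-1) \<Longrightarrow> r = 0"
      by (auto simp: gauge_space_iff poly_eq_iff)
    then show ?thesis using 0 assms by auto
  next
    case (Suc d')
    then show ?thesis using least[of d'] by simp
  qed
  then show ?thesis
  proof (intro ex1I[of _ d])
    fix d' assume "r \<in> gauge_space (int d') - gauge_space (int d' - 1)"
    then show "d' = d" using d \<open>r \<notin> gauge_space (int d - 1)\<close>
      using mono[of "int d" "int d' - 1"] mono[of "int d'" "int d - 1"]
      by (cases d d' rule: linorder_cases) auto
  qed (use d in simp)
qed

end

theory Submission
  imports Defs
begin

text \<open>
  All elements of the ideals \<open>a_e\<close>, \<open>e \<ge> 1\<close>, are divisible by \<open>x\<close>, so the product of elements of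
  positive degrees \<open>a\<close> and \<open>b\<close> comes from a polynomial in \<open>x^(p^b) * x R\<close>, hence divisible by
  \<open>x^3\<close>. Thus products never help to generate \<open>x^2\<close> and \<open>x y^(e p^e)\<close>, exactly two new generators are
  needed in each degree \<open>e \<ge> 1\<close>, and \<open>k_e = 2 e\<close>. On the other hand, any set of right module
  generators contains in each degree \<open>e\<close> an element \<open>\<kappa>^e f\<close> for which \<open>x y^(e p^e)\<close> occurs in \<open>f\<close>;
  it maps a multiple of \<open>x^(p^e - 2) y^(p^e - 1)\<close> to a polynomial in which \<open>y^e\<close> occurs, so
  the gauge is not bounded.
\<close>

section \<open>Coefficients and products of monomials in two variables\<close>

abbreviation coeff2 :: "'k::field poly poly \<Rightarrow> nat \<Rightarrow> nat \<Rightarrow> 'k" where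
  "coeff2 f i j \<equiv> Polynomial.coeff (Polynomial.coeff f j) i"

lemma mono2_mult: "mono2 c i j * mono2 d k l = mono2 (c * d) (i + k) (j + l)"
  by (simp add: mono2_def mult_monom)

lemma coeff2_mult_mono2:
  "coeff2 (f * mono2 c i j) m n = (if i \<le> m \<and> j \<le> n then coeff2 f (m - i) (n - j) * c else 0)"
  unfolding mono2_def mult.commute[of f] Polynomial.coeff_monom_mult
  by (simp add: Polynomial.coeff_monom_mult mult.commute)

lemma mono2_power: "mono2 1 i j ^ n = mono2 1 (i * n) (j * n)"
  by (simp add: mono2_def monom_power)

lemma varx_square: "varx ^ 2 = mono2 1 2 0"
  by (simp add: varx_def mono2_power)

lemma varx_vary_power: "varx * vary ^ N = mono2 1 1 N"
  by (simp add: varx_def vary_def mono2_power mono2_mult)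


section \<open>Gauges\<close>

lemma gauge_cases:
  assumes "r \<noteq> 0"
  obtains d where "gauge r = ereal (real d)" "r \<in> gauge_space (int d)"
    "r \<notin> gauge_space (int d - 1)"
proof
  let ?d = "THE d. r \<in> gauge_space (int d) - gauge_space (int d - 1)"
  show "gauge r = ereal (real ?d)" using assms by (simp add: gauge_def)
  show "r \<in> gauge_space (int ?d)" "r \<notin> gauge_space (int ?d - 1)"
    using theI'[OF gauge_unique[OF assms]] by blast+
qed

text \<open>Only the exponent of \<open>y\<close> is recorded, since it is the one that grows
  without bound in the example.\<close>

lemma gauge_ge_coeff2:
  assumes "coeff2 r i j \<noteq> 0"
  shows "gauge r \<ge> ereal (real j)"
proof -
  have "r \<noteq> 0" using assms by auto
  then obtain d where "gauge r = ereal (real d)" "r \<in> gauge_space (int d)" by (rule gauge_cases)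
  then show ?thesis using assms by (auto simp: gauge_space_iff)
qed

text \<open>Only an inequality, because \<open>c\<close> may be zero, and then the gauge is minus
  infinity.\<close>

lemma gauge_mono2_le:
  assumes "i \<le> d" "j \<le> d"
  shows "gauge (mono2 c i j) \<le> ereal (real d)"
proof (cases "mono2 c i j = 0")
  case True
  then show ?thesis by (simp add: gauge_def)
next
  case False
  then obtain d' where d': "gauge (mono2 c i j) = ereal (real d')"
    "mono2 c i j \<notin> gauge_space (int d' - 1)" by (rule gauge_cases)
  have "mono2 c i j \<in> gauge_space b" if "int i \<le> b" "int j \<le> b" for b
    using that by (auto simp: gauge_space_iff mono2_def split: if_splits)
  then have "\<not> (int i \<le> int d' - 1 \<and> int j \<le> int d' - 1)" using d'(2) by blast
  then have "d' \<le> d" using assms by linarith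
  then show ?thesis using d'(1) by simp
qed


section \<open>The ideals\<close>

lemma example_ideal_0: "example_ideal p 0 = UNIV"
  by (simp add: example_ideal_def)

lemma module_mult: "Modules.module ((*) :: 'a::comm_ring_1 \<Rightarrow> _)"
  by standard (simp_all add: algebra_simps)

lemma example_ideal_iff:
  assumes "e > 0"
  shows "f \<in> example_ideal p e \<longleftrightarrow>
    (\<exists>u v. f = u * mono2 1 2 0 + v * mono2 1 1 (e * p ^ e))"
proof -
  interpret Modules.module "(*) :: 'a poly poly \<Rightarrow> _" by (rule module_mult)
  have e: "e \<noteq> 0" using assms by simp
  \<comment> \<open>The left side is the form in which \<open>span_breakdown_eq\<close>, applied
    once per generator, leaves membership in the span.\<close>
  have eq: "f - u * mono2 1 2 0 - v * mono2 1 1 (e * p ^ e) = 0 \<longleftrightarrow>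
      f = u * mono2 1 2 0 + v * mono2 1 1 (e * p ^ e)" for u v
    unfolding diff_diff_add right_minus_eq ..
  have "f \<in> example_ideal p e \<longleftrightarrow> f \<in> span {mono2 1 2 0, mono2 1 1 (e * p ^ e)}"
    using e by (simp add: example_ideal_def varx_square varx_vary_power)
  also have "\<dots> \<longleftrightarrow> (\<exists>u v. f - u * mono2 1 2 0 - v * mono2 1 1 (e * p ^ e) = 0)"
    by (simp only: span_breakdown_eq span_empty singleton_iff)
  finally show ?thesis by (simp only: eq)
qed

lemma
  fixes f g :: "'k::field poly poly"
  shows example_ideal_zero: "(0 :: 'k poly poly) \<in> example_ideal p e"
  and example_ideal_add:
    "f \<in> example_ideal p e \<Longrightarrow> g \<in> example_ideal p e \<Longrightarrow> f + g \<in> example_ideal p e"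
  and example_ideal_mult: "f \<in> example_ideal p e \<Longrightarrow> r * f \<in> example_ideal p e"
proof -
  interpret Modules.module "(*) :: 'k poly poly \<Rightarrow> _" by (rule module_mult)
  show "(0 :: 'k poly poly) \<in> example_ideal p e"
    "f \<in> example_ideal p e \<Longrightarrow> g \<in> example_ideal p e \<Longrightarrow> f + g \<in> example_ideal p e"
    "f \<in> example_ideal p e \<Longrightarrow> r * f \<in> example_ideal p e"
    unfolding example_ideal_def by (cases "e = 0"; simp add: span_zero span_add span_scale)+
qed

lemma example_ideal_sum:
  "(\<And>i. i \<in> A \<Longrightarrow> f i \<in> example_ideal p e) \<Longrightarrow> sum f A \<in> example_ideal p e"
  by (induction A rule: infinite_finite_induct) (auto intro: example_ideal_zero example_ideal_add)

lemma example_ideal_uminus: "f \<in> example_ideal p e \<Longrightarrow> - f \<in> example_ideal p e"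
  using example_ideal_mult[of f p e "-1"] by simp

lemma varx_square_dvd_in_example_ideal:
  assumes "varx ^ 2 dvd f"
  shows "f \<in> example_ideal p e"
proof (cases "e = 0")
  case False
  obtain u where "f = mono2 1 2 0 * u" using assms by (auto simp: varx_square)
  then have "f = u * mono2 1 2 0 + 0 * mono2 1 1 (e * p ^ e)" by (simp add: mult.commute)
  then show ?thesis using False example_ideal_iff by blast
qed (simp add: example_ideal_0)

lemma varx_vary_in_example_ideal:
  assumes "e > 0"
  shows "varx * vary ^ (e * p ^ e) \<in> example_ideal p e"
proof -
  have "varx * vary ^ (e * p ^ e) = 0 * mono2 1 2 0 + 1 * mono2 1 1 (e * p ^ e)"
    by (simp add: varx_vary_power)
  then show ?thesis using assms example_ideal_iff by blast
qed

section \<open>Divisibility by powers of \<open>x\<close> and behaviour under products\<close>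

lemma varx_dvd_example_ideal:
  assumes "e > 0" "f \<in> example_ideal p e"
  shows "varx dvd f"
proof -
  obtain u v where f: "f = u * varx ^ 2 + v * (varx * vary ^ (e * p ^ e))"
    using assms by (auto simp: example_ideal_iff varx_square varx_vary_power)
  show ?thesis unfolding f by (simp add: power2_eq_square)
qed

text \<open>
  Two copies of \<open>x\<close> come from the Frobenius power and one from the other factor: this is why
  products of elements of positive degree do not help generating \<open>x^2\<close> and \<open>x y^(e p^e)\<close>.
\<close>

lemma varx_cube_dvd_example_ideal_product:
  assumes "p \<ge> 2" "a > 0" "b > 0" "f \<in> example_ideal p a" "g \<in> example_ideal p b"
  shows "varx ^ 3 dvd f ^ (p ^ b) * g"
proof -
  have "b < p ^ b" using assms(1) by (intro power_gt_expt) simp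
  then have "2 \<le> p ^ b" using assms(3) by linarith
  then have "varx ^ 2 dvd f ^ (p ^ b)"
    using varx_dvd_example_ideal[OF assms(2,4)] by (rule dvd_power_le[rotated])
  then have "varx ^ 2 * varx dvd f ^ (p ^ b) * g"
    using varx_dvd_example_ideal[OF assms(3,5)] by (rule mult_dvd_mono)
  then show ?thesis by (simp add: eval_nat_numeral mult.assoc)
qed

text \<open>\<open>f ^ (p ^ b) * g\<close> is the coefficient of the product of the elements with
  coefficients \<open>f\<close> and \<open>g\<close>, so this gives closure under products. If
  \<open>a\<close> or \<open>b\<close> is 0, it is a multiple of \<open>g\<close> or
  \<open>f\<close>; otherwise divisibility by \<open>x^3\<close> puts it into
  \<open>(x^2)\<close>.\<close>

lemma example_ideal_frobenius_mult:
  assumes "p \<ge> 2" "f \<in> example_ideal p a" "g \<in> example_ideal p b"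
  shows "f ^ (p ^ b) * g \<in> example_ideal p (a + b)"
proof (cases "a = 0 \<or> b = 0")
  case True
  then show ?thesis
    using example_ideal_mult[OF assms(2), of g] example_ideal_mult[OF assms(3), of "f ^ (p ^ b)"]
    by (auto simp: mult.commute)
next
  case False
  then have "varx ^ 3 dvd f ^ (p ^ b) * g"
    using varx_cube_dvd_example_ideal_product assms by blast
  then have "varx ^ 2 dvd f ^ (p ^ b) * g" by (rule dvd_trans[rotated]) (simp add: le_imp_power_dvd)
  then show ?thesis by (rule varx_square_dvd_in_example_ideal)
qed

text \<open>As \<open>e * p ^ e > 0\<close>, neither monomial generator divides the other. For
  \<open>f = u x^2 + v x y^(e p^e)\<close> the two coefficients are therefore the constant terms of
  \<open>u\<close> and \<open>v\<close>, and taking constant terms is multiplicative.\<close>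

lemma coeff2_example_ideal_mult:
  assumes "p > 0" "e > 0" "f \<in> example_ideal p e"
  shows "coeff2 (r * f) 2 0 = coeff2 r 0 0 * coeff2 f 2 0"
    and "coeff2 (r * f) 1 (e * p ^ e) = coeff2 r 0 0 * coeff2 f 1 (e * p ^ e)"
proof -
  obtain u v where f: "f = u * mono2 1 2 0 + v * mono2 1 1 (e * p ^ e)"
    using assms by (auto simp: example_ideal_iff)
  have rf: "r * f = (r * u) * mono2 1 2 0 + (r * v) * mono2 1 1 (e * p ^ e)"
    by (simp add: f algebra_simps)
  have c: "coeff2 (u * mono2 1 2 0 + v * mono2 1 1 (e * p ^ e)) 2 0 = coeff2 u 0 0"
    "coeff2 (u * mono2 1 2 0 + v * mono2 1 1 (e * p ^ e)) 1 (e * p ^ e) = coeff2 v 0 0" for u v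
    using assms(1,2) by (simp_all add: coeff2_mult_mono2)
  show "coeff2 (r * f) 2 0 = coeff2 r 0 0 * coeff2 f 2 0"
    "coeff2 (r * f) 1 (e * p ^ e) = coeff2 r 0 0 * coeff2 f 1 (e * p ^ e)"
    unfolding rf unfolding f c by (simp_all add: Polynomial.coeff_mult_0)
qed

lemma coeff2_varx_cube_dvd:
  assumes "varx ^ 3 dvd f" "i \<le> 2"
  shows "coeff2 f i j = 0"
proof -
  obtain u where "f = varx ^ 3 * u" using assms(1) by (rule dvdE)
  then have "f = u * mono2 1 3 0" by (simp add: varx_def mono2_power mult.commute[of u])
  then show ?thesis using assms(2) by (simp add: coeff2_mult_mono2)
qed


section \<open>Elements of the total Cartier algebra as families of polynomials\<close>

locale cartier_operator =
  fixes p :: nat and lam :: "'k::field \<Rightarrow> 'k"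
  assumes prime_p: "prime p" and char_p: "CHAR('k) = p"
    and lam_hom: "lam \<in> frob_hom p 1" and lam_nonzero: "\<exists>c. lam c \<noteq> 0"
begin

abbreviation kap :: "nat \<Rightarrow> 'k poly poly \<Rightarrow> 'k poly poly" where
  "kap \<equiv> kappa p lam"

abbreviation C :: "(nat \<Rightarrow> 'k poly poly \<Rightarrow> 'k poly poly) ring" where
  "C \<equiv> cartier_algebra p"

sublocale C: ring C
  by (rule ring_cartier_algebra)

lemmas coeff_kap = coeff_kappa[OF prime_p char_p lam_hom]

section \<open>Powers of the Cartier operator\<close>

lemma p_ge_2: "p \<ge> 2"
  using prime_p by (rule prime_ge_2_nat)

lemma kap_hom: "kap e \<in> frob_hom p e"
  using is_cartier_operator_kappa[OF prime_p char_p lam_hom] by (simp add: is_cartier_operator_def)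

lemma kap_0: "kap 0 f = f"
  by (subst kappa_eq_funpow[OF prime_p char_p lam_hom]) simp

lemma kap_kap: "kap a (kap b f) = kap (a + b) f"
proof -
  note eq = kappa_eq_funpow[OF prime_p char_p lam_hom]
  show ?thesis by (subst (1 2 3) eq) (simp add: funpow_add)
qed

text \<open>The image of \<open>lam\<close> is a \<open>k\<close>-subspace of \<open>k\<close>, and
  it is nonzero: rescaling \<open>c\<close> by a \<open>p\<close>-th power reaches every
  value.\<close>

lemma surj_lam: "surj lam"
proof -
  obtain c where c: "lam c \<noteq> 0" using lam_nonzero by blast
  have "lam ((a / lam c) ^ p * c) = a" for a
    using frob_hom_scale[OF lam_hom, of "a / lam c" c] c by simp
  then show ?thesis by (rule surjI)
qed

text \<open>An iterate of \<open>lam\<close> can kill a nonzero coefficient; the factor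
  \<open>c\<close> turns \<open>a\<close> into a preimage of 1.\<close>

lemma funpow_lam_nonzero:
  assumes "a \<noteq> 0"
  obtains c where "c \<noteq> 0" "(lam ^^ e) (a * c) \<noteq> 0"
proof -
  have "surj (lam ^^ e)" using surj_lam by (simp add: surj_fn)
  then obtain b where b: "1 = (lam ^^ e) b" by (rule surjE)
  have "(lam ^^ e) 0 = 0" by (rule frob_hom_zero[OF funpow_frob_hom[OF lam_hom]])
  then have "b \<noteq> 0" using b by auto
  then show thesis using that[of "b / a"] b assms by simp
qed

text \<open>Multiplication by a monomial moves a nonzero coefficient of \<open>f - g\<close> to a
  position that \<open>kap e\<close> reads, so \<open>kap e\<close> generates a free right
  module.\<close>

lemma kap_mult_inj:
  assumes "\<And>r. kap e (f * r) = kap e (g * r)"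
  shows "f = g"
proof (rule poly_eqI, rule poly_eqI, rule ccontr)
  fix j i
  let ?h = "f - g" and ?q = "p ^ e"
  assume "coeff2 f i j \<noteq> coeff2 g i j"
  then have "coeff2 ?h i j \<noteq> 0" by simp
  then obtain c where c: "(lam ^^ e) (coeff2 ?h i j * c) \<noteq> 0" by (rule funpow_lam_nonzero)
  have q: "?q > 0" using prime_p by (simp add: prime_gt_0_nat)
  have le: "n \<le> n * ?q + (?q - 1)" for n
    using q by (metis le_add1 mult_le_mono2 nat_mult_1_right Suc_leI One_nat_def le_trans)
  \<comment> \<open>Shifts the exponents \<open>(i, j)\<close> to those from which
    \<open>kap e\<close> computes the coefficient at \<open>(i, j)\<close>.\<close>
  let ?r = "mono2 c (i * ?q + (?q - 1) - i) (j * ?q + (?q - 1) - j)"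
  have "coeff2 (?h * ?r) (i * ?q + (?q - 1)) (j * ?q + (?q - 1)) = coeff2 ?h i j * c"
    using le[of i] le[of j] by (simp only: coeff2_mult_mono2) simp
  then have "coeff2 (kap e (?h * ?r)) i j \<noteq> 0" using c by (simp only: coeff_kap not_False_eq_True)
  moreover have "kap e (?h * ?r) = 0"
    using frob_hom_add[OF kap_hom, of e "?h * ?r" "g * ?r"] assms[of ?r]
    by (simp add: algebra_simps)
  ultimately show False by simp
qed

section \<open>Coefficient families relative to the powers of the Cartier operator\<close>

definition family :: "(nat \<Rightarrow> 'k poly poly) \<Rightarrow> nat \<Rightarrow> 'k poly poly \<Rightarrow> 'k poly poly" where
  "family f = (\<lambda>e r. kap e (f e * r))"

definition homog :: "nat \<Rightarrow> 'k poly poly \<Rightarrow> nat \<Rightarrow> 'k poly poly" where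
  "homog d f = (\<lambda>e. if e = d then f else 0)"

lemma kap_zero: "kap e 0 = 0"
  by (rule frob_hom_zero[OF kap_hom])

text \<open>By \<open>kap_mult_inj\<close> the coefficients are unique, so questions about the
  algebra become questions about polynomials.\<close>

lemma family_eq_iff: "family f e = family g e \<longleftrightarrow> f e = g e"
  by (auto simp: family_def fun_eq_iff intro: kap_mult_inj)

lemma family_eq_zero_iff: "family f e = (\<lambda>_. 0) \<longleftrightarrow> f e = 0"
  using family_eq_iff[of f e "\<lambda>_. 0"] by (simp add: family_def kap_zero)

lemma family_carrier: "family f \<in> carrier C \<longleftrightarrow> finite {e. f e \<noteq> 0}"
proof -
  have "family f e \<in> frob_hom p e" for e
    using kap_hom[of e]
    by (simp add: frob_hom_def family_def distrib_left mult.left_commute[of "f e"])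
  then show ?thesis by (simp add: cartier_algebra_def family_eq_zero_iff)
qed

lemma family_zero: "family (\<lambda>_. 0) = \<zero>\<^bsub>C\<^esub>"
  by (simp add: family_def kap_zero cartier_algebra_def)

lemma family_scalar: "family (homog 0 r) = scalar r"
  by (auto simp: family_def homog_def scalar_def fun_eq_iff kap_0 kap_zero)

lemma family_one: "family (homog 0 1) = \<one>\<^bsub>C\<^esub>"
  by (simp add: family_scalar scalar_def cartier_algebra_def cong: if_cong)

lemma family_add: "family f \<oplus>\<^bsub>C\<^esub> family g = family (\<lambda>e. f e + g e)"
  by (simp add: cartier_algebra_def family_def distrib_right frob_hom_add[OF kap_hom])

lemma finite_support_homog: "finite {e. homog d f e \<noteq> 0}"
  by (rule finite_subset[of _ "{d}"]) (auto simp: homog_def)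

lemma family_uminus:
  assumes "finite {e. f e \<noteq> 0}"
  shows "\<ominus>\<^bsub>C\<^esub> family f = family (\<lambda>e. - f e)"
  by (rule C.minus_equality) (use assms in \<open>simp_all add: family_carrier family_add family_zero\<close>)

text \<open>
  By the projection formula \<open>f * kap b (g * r) = kap b (f ^ (p ^ b) * g * r)\<close>, the algebra
  is a skew polynomial ring in \<open>kap 1\<close>, with coefficients written on the right.
\<close>

definition family_mult ::
    "(nat \<Rightarrow> 'k poly poly) \<Rightarrow> (nat \<Rightarrow> 'k poly poly) \<Rightarrow> nat \<Rightarrow> 'k poly poly" where
  "family_mult f g = (\<lambda>e. \<Sum>a\<le>e. f a ^ (p ^ (e - a)) * g (e - a))"

lemma family_mult: "family f \<otimes>\<^bsub>C\<^esub> family g = family (family_mult f g)"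
proof -
  have "kap a (f a * kap (e - a) (g (e - a) * r)) = kap e (f a ^ (p ^ (e - a)) * g (e - a) * r)"
    if "a \<le> e" for a e r
    using frob_hom_scale[OF kap_hom, of "e - a" "f a" "g (e - a) * r"] that
    by (simp add: kap_kap mult.assoc flip: frob_hom_scale[OF kap_hom])
  then show ?thesis
    by (simp add: cartier_algebra_def family_def family_mult_def fun_eq_iff sum_distrib_right
        frob_hom_sum[OF kap_hom])
qed

text \<open>On the right a scalar enters without a Frobenius power, so ideal membership translates
  directly into generation.\<close>

lemma family_mult_scalar:
  "family (homog d f) \<otimes>\<^bsub>C\<^esub> scalar r = family (homog d (f * r))"
proof -
  have "family_mult (homog d f) (homog 0 r) e = homog d (f * r) e" for e
  proof -
    \<comment> \<open>Only the summand \<open>a = e\<close> survives, with exponent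
      \<open>p ^ 0 = 1\<close>.\<close>
    have "homog d f a ^ (p ^ (e - a)) * homog 0 r (e - a) =
        (if a = e then homog d (f * r) e else 0)" if "a \<le> e" for a
      using that by (auto simp: homog_def)
    then show ?thesis by (simp add: family_mult_def)
  qed
  then show ?thesis by (simp add: family_mult flip: family_scalar) (metis ext)
qed


section \<open>The Cartier algebra of the example\<close>

definition D :: "(nat \<Rightarrow> 'k poly poly \<Rightarrow> 'k poly poly) set" where
  "D = ideal_sum_algebra p lam (example_ideal p)"

lemma D_eq: "D = {family f | f. (\<forall>e. f e \<in> example_ideal p e) \<and> finite {e. f e \<noteq> 0}}"
proof safe
  fix \<phi> assume \<phi>: "\<phi> \<in> D"
  then have "\<forall>e. \<exists>f. \<phi> e = (\<lambda>r. kap e (f * r)) \<and> f \<in> example_ideal p e"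
    by (auto simp: D_def ideal_sum_algebra_def)
  then obtain f where f: "\<And>e. \<phi> e = (\<lambda>r. kap e (f e * r))" "\<forall>e. f e \<in> example_ideal p e"
    by metis
  then have "\<phi> = family f" by (simp add: family_def fun_eq_iff)
  moreover have "\<phi> \<in> carrier C" using \<phi> by (simp add: D_def ideal_sum_algebra_def)
  ultimately show "\<exists>f. \<phi> = family f \<and> (\<forall>e. f e \<in> example_ideal p e) \<and> finite {e. f e \<noteq> 0}"
    using f(2) family_carrier by blast
next
  fix f :: "nat \<Rightarrow> 'k poly poly"
  assume "\<forall>e. f e \<in> example_ideal p e" "finite {e. f e \<noteq> 0}"
  then show "family f \<in> D"
    unfolding D_def ideal_sum_algebra_def using family_carrier[of f] by (auto simp: family_def)
qed

lemma D_cases: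
  assumes "\<phi> \<in> D"
  obtains f where "\<phi> = family f" "\<forall>e. f e \<in> example_ideal p e" "finite {e. f e \<noteq> 0}"
  using assms unfolding D_eq by blast

lemma family_in_D:
  "\<forall>e. f e \<in> example_ideal p e \<Longrightarrow> finite {e. f e \<noteq> 0} \<Longrightarrow> family f \<in> D"
  unfolding D_eq by blast

lemma D_subset_carrier: "D \<subseteq> carrier C"
  by (auto simp: D_def ideal_sum_algebra_def)

lemma homog_in_D: "f \<in> example_ideal p d \<Longrightarrow> family (homog d f) \<in> D"
  by (rule family_in_D) (auto simp: finite_support_homog homog_def example_ideal_zero)

lemma subring_D: "subring D C"
proof (rule C.subringI[OF D_subset_carrier])
  show "\<one>\<^bsub>C\<^esub> \<in> D"
    using homog_in_D[of 1 0] by (simp add: family_one example_ideal_0)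
next
  fix \<phi> assume "\<phi> \<in> D"
  then obtain f where f: "\<phi> = family f" "\<forall>e. f e \<in> example_ideal p e" "finite {e. f e \<noteq> 0}"
    by (rule D_cases)
  then show "\<ominus>\<^bsub>C\<^esub> \<phi> \<in> D"
    by (auto simp: family_uminus intro!: family_in_D example_ideal_uminus)
next
  fix \<phi> \<psi> assume "\<phi> \<in> D" "\<psi> \<in> D"
  obtain f where f: "\<phi> = family f" "\<forall>e. f e \<in> example_ideal p e" "finite {e. f e \<noteq> 0}"
    using \<open>\<phi> \<in> D\<close> by (rule D_cases)
  obtain g where g: "\<psi> = family g" "\<forall>e. g e \<in> example_ideal p e" "finite {e. g e \<noteq> 0}"
    using \<open>\<psi> \<in> D\<close> by (rule D_cases)
  have carr: "\<phi> \<in> carrier C" "\<psi> \<in> carrier C"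
    using D_subset_carrier \<open>\<phi> \<in> D\<close> \<open>\<psi> \<in> D\<close> by auto
  have "family_mult f g e \<in> example_ideal p e" for e
    unfolding family_mult_def
  proof (rule example_ideal_sum)
    fix a assume "a \<in> {..e}"
    then show "f a ^ (p ^ (e - a)) * g (e - a) \<in> example_ideal p e"
      using example_ideal_frobenius_mult[OF p_ge_2 spec[OF f(2), of a] spec[OF g(2), of "e - a"]] by simp
  qed
  \<comment> \<open>Finiteness of the support is inherited from closure of the total Cartier
    algebra.\<close>
  moreover have "finite {e. family_mult f g e \<noteq> 0}"
    using C.m_closed[OF carr] by (simp add: f(1) g(1) family_mult family_carrier)
  ultimately show "\<phi> \<otimes>\<^bsub>C\<^esub> \<psi> \<in> D" by (simp add: f(1) g(1) family_mult family_in_D)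
  have "finite {e. f e + g e \<noteq> 0}"
    using C.a_closed[OF carr] by (simp add: f(1) g(1) family_add family_carrier)
  then show "\<phi> \<oplus>\<^bsub>C\<^esub> \<psi> \<in> D"
    using f(2) g(2) by (simp add: f(1) g(1) family_add family_in_D example_ideal_add)
qed

lemma component_family: "component (family f) d = family (homog d (f d))"
  by (auto simp: component_def family_def homog_def fun_eq_iff kap_zero)

lemma family_homog_in_degree_part:
  "f \<in> example_ideal p d \<Longrightarrow> family (homog d f) \<in> degree_part D d"
  by (auto simp: degree_part_def homog_in_D family_eq_zero_iff) (simp add: homog_def)

lemma degree_part_D_0: "degree_part D 0 = range scalar"
proof
  show "degree_part D 0 \<subseteq> range scalar"
    using D_subset_carrier degree_part_zero_cartier_algebra[of p, where 'r = "'k poly poly"]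
    by (auto simp: degree_part_def)
  show "range scalar \<subseteq> degree_part D 0"
    using family_homog_in_degree_part[of _ 0] by (auto simp: example_ideal_0 family_scalar)
qed

text \<open>Shows that \<open>D_0\<close> needs no generators over itself, which gives the value at
  negative indices.\<close>

lemma subring_scalars: "subring (range scalar) C"
proof (rule C.subringI)
  show "range scalar \<subseteq> carrier C"
    using finite_support_homog by (auto simp: family_carrier simp flip: family_scalar)
  show "\<one>\<^bsub>C\<^esub> \<in> range scalar" unfolding family_one[symmetric] family_scalar by blast
next
  fix \<phi> :: "nat \<Rightarrow> 'k poly poly \<Rightarrow> 'k poly poly"
  assume "\<phi> \<in> range scalar"
  then obtain r where r: "\<phi> = family (homog 0 r)" by (auto simp: family_scalar)
  have "(\<lambda>e. - homog 0 r e) = homog 0 (- r)" by (auto simp: homog_def)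
  then have "\<ominus>\<^bsub>C\<^esub> \<phi> = scalar (- r)"
    unfolding r family_uminus[OF finite_support_homog] by (simp add: family_scalar)
  then show "\<ominus>\<^bsub>C\<^esub> \<phi> \<in> range scalar" by blast
next
  fix \<phi> \<psi> :: "nat \<Rightarrow> 'k poly poly \<Rightarrow> 'k poly poly"
  assume "\<phi> \<in> range scalar" "\<psi> \<in> range scalar"
  then obtain r s where rs: "\<phi> = family (homog 0 r)" "\<psi> = family (homog 0 s)"
    by (auto simp: family_scalar)
  have "\<phi> \<otimes>\<^bsub>C\<^esub> \<psi> = scalar (r * s)"
    using family_mult_scalar[of 0 r s] by (simp add: rs family_scalar)
  then show "\<phi> \<otimes>\<^bsub>C\<^esub> \<psi> \<in> range scalar" by blast
  have "(\<lambda>e. homog 0 r e + homog 0 s e) = homog 0 (r + s)" by (auto simp: homog_def)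
  then have "\<phi> \<oplus>\<^bsub>C\<^esub> \<psi> = scalar (r + s)"
    unfolding rs family_add by (simp add: family_scalar)
  then show "\<phi> \<oplus>\<^bsub>C\<^esub> \<psi> \<in> range scalar" by blast
qed

lemma cartier_subalgebra_D: "cartier_subalgebra p D"
  unfolding cartier_subalgebra_def
proof (intro conjI ballI allI)
  fix \<phi> d assume "\<phi> \<in> D"
  then obtain f where "\<phi> = family f" "\<forall>e. f e \<in> example_ideal p e" by (rule D_cases)
  then show "component \<phi> d \<in> D" by (simp add: component_family homog_in_D)
next
  have "family (homog 1 (varx ^ 2)) \<in> degree_part D 1"
    by (intro family_homog_in_degree_part varx_square_dvd_in_example_ideal) simp
  moreover have "family (homog 1 (varx ^ 2)) \<noteq> \<zero>\<^bsub>C\<^esub>"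
  proof
    assume "family (homog 1 (varx ^ 2)) = \<zero>\<^bsub>C\<^esub>"
    then have "family (homog 1 (varx ^ 2)) 1 = (\<lambda>_. 0)" by (simp add: cartier_algebra_def)
    then show False by (simp add: family_eq_zero_iff homog_def varx_def mono2_def)
  qed
  ultimately show "\<exists>e>0. degree_part D e \<noteq> {\<zero>\<^bsub>C\<^esub>}" by (intro exI[of _ 1]) auto
qed (fact subring_D degree_part_D_0)+


subsection \<open>Generators and complexity\<close>

lemma family_in_D_iff:
  "family f \<in> D \<longleftrightarrow> (\<forall>e. f e \<in> example_ideal p e) \<and> finite {e. f e \<noteq> 0}"
proof
  assume "family f \<in> D"
  then obtain g where g: "family f = family g" "\<forall>e. g e \<in> example_ideal p e"
    "finite {e. g e \<noteq> 0}" by (rule D_cases)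
  then have "f = g" using family_eq_iff by (metis ext)
  then show "(\<forall>e. f e \<in> example_ideal p e) \<and> finite {e. f e \<noteq> 0}" using g by blast
qed (use family_in_D in blast)

text \<open>
  A functional on the classes of \<open>x^2\<close> and \<open>x y^(d p^d)\<close>; the elements of \<open>D\<close> on which it
  vanishes in degree \<open>d\<close> form a subring, which shows that both classes need their own generator.
\<close>

definition functional :: "nat \<Rightarrow> 'k \<Rightarrow> 'k \<Rightarrow> 'k poly poly \<Rightarrow> 'k" where
  "functional d \<alpha> \<beta> f = \<alpha> * coeff2 f 2 0 + \<beta> * coeff2 f 1 (d * p ^ d)"

lemma functional_zero: "functional d \<alpha> \<beta> 0 = 0"
  and functional_add: "functional d \<alpha> \<beta> (f + g) = functional d \<alpha> \<beta> f + functional d \<alpha> \<beta> g"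
  and functional_uminus: "functional d \<alpha> \<beta> (- f) = - functional d \<alpha> \<beta> f"
  by (simp_all add: functional_def distrib_left)

lemma functional_sum: "functional d \<alpha> \<beta> (sum f A) = (\<Sum>i\<in>A. functional d \<alpha> \<beta> (f i))"
  by (induction A rule: infinite_finite_induct) (simp_all add: functional_zero functional_add)

text \<open>On the ideal in degree \<open>d\<close> the functional factors through the quotient by
  \<open>(x, y)\<close> times the ideal.\<close>

lemma functional_mult:
  assumes "d > 0" "f \<in> example_ideal p d"
  shows "functional d \<alpha> \<beta> (r * f) = coeff2 r 0 0 * functional d \<alpha> \<beta> f"
proof -
  have "p > 0" using p_ge_2 by simp
  show ?thesis
    unfolding functional_def coeff2_example_ideal_mult[OF \<open>p > 0\<close> assms]
    by (simp add: algebra_simps)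
qed

lemma functional_varx_cube_dvd: "varx ^ 3 dvd f \<Longrightarrow> functional d \<alpha> \<beta> f = 0"
  by (simp add: functional_def coeff2_varx_cube_dvd)

lemma functional_varx_square: "d > 0 \<Longrightarrow> functional d \<alpha> \<beta> (varx ^ 2) = \<alpha>"
  and functional_varx_vary: "d > 0 \<Longrightarrow> functional d \<alpha> \<beta> (varx * vary ^ (d * p ^ d)) = \<beta>"
  using prime_gt_0_nat[OF prime_p]
  by (auto simp: functional_def varx_square varx_vary_power mono2_def)

text \<open>In degree \<open>d\<close> a product is a sum of terms
  \<open>f_a^(p^(d-a)) g_(d-a)\<close>. Those with \<open>a = 0\<close> and \<open>a = d\<close> are
  multiples of \<open>g_d\<close> and \<open>f_d\<close>, hence killed by
  \<open>functional_mult\<close>; the remaining ones are divisible by \<open>x^3\<close>.\<close>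

lemma subring_functional:
  assumes d: "d > 0"
  shows "subring {family f | f. family f \<in> D \<and> functional d \<alpha> \<beta> (f d) = 0} C" (is "subring ?K C")
proof (rule C.subringI)
  show "?K \<subseteq> carrier C" using D_subset_carrier by auto
  have "family (homog 0 1) \<in> D" using subringE(3)[OF subring_D] by (simp add: family_one)
  moreover have "functional d \<alpha> \<beta> (homog 0 1 d) = 0" using d by (simp add: homog_def functional_zero)
  ultimately show "\<one>\<^bsub>C\<^esub> \<in> ?K" unfolding family_one[symmetric] by blast
next
  fix \<phi> assume "\<phi> \<in> ?K"
  then obtain f where f: "\<phi> = family f" "family f \<in> D" "functional d \<alpha> \<beta> (f d) = 0" by blast
  have eq: "\<ominus>\<^bsub>C\<^esub> \<phi> = family (\<lambda>e. - f e)"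
    unfolding f(1) by (rule family_uminus) (use f(2) in \<open>simp add: family_in_D_iff\<close>)
  have "\<ominus>\<^bsub>C\<^esub> \<phi> \<in> D" unfolding f(1) by (rule subringE(5)[OF subring_D f(2)])
  then have "family (\<lambda>e. - f e) \<in> D" by (simp only: eq)
  moreover have "functional d \<alpha> \<beta> (- f d) = 0" by (simp add: functional_uminus f(3))
  ultimately show "\<ominus>\<^bsub>C\<^esub> \<phi> \<in> ?K" unfolding eq by blast
next
  fix \<phi> \<psi> assume "\<phi> \<in> ?K" "\<psi> \<in> ?K"
  then obtain f g where f: "\<phi> = family f" "family f \<in> D" "functional d \<alpha> \<beta> (f d) = 0"
    and g: "\<psi> = family g" "family g \<in> D" "functional d \<alpha> \<beta> (g d) = 0" by blast
  have "family (\<lambda>e. f e + g e) \<in> D"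
    using subringE(7)[OF subring_D f(2) g(2)] by (simp add: family_add)
  moreover have "functional d \<alpha> \<beta> (f d + g d) = 0" by (simp add: functional_add f(3) g(3))
  ultimately show "\<phi> \<oplus>\<^bsub>C\<^esub> \<psi> \<in> ?K" unfolding f(1) g(1) family_add by blast
  have ideal: "f a \<in> example_ideal p a" "g a \<in> example_ideal p a" for a
    using f(2) g(2) by (simp_all add: family_in_D_iff)
  have "functional d \<alpha> \<beta> (f a ^ (p ^ (d - a)) * g (d - a)) = 0" if le: "a \<le> d" for a
  proof -
    consider "a = 0" | "a = d" | "a > 0" "d - a > 0" using le by fastforce
    then show ?thesis
    proof cases
      case 1
      then show ?thesis by (simp add: functional_mult[OF d ideal(2)] g(3))
    next
      case 2
      have "functional d \<alpha> \<beta> (g 0 * f d) = 0" by (simp add: functional_mult[OF d ideal(1)] f(3))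
      then show ?thesis using 2 by (simp add: mult.commute)
    next
      case 3
      then show ?thesis
        using varx_cube_dvd_example_ideal_product[OF p_ge_2 3 ideal] functional_varx_cube_dvd by blast
    qed
  qed
  then have "functional d \<alpha> \<beta> (family_mult f g d) = 0"
    by (simp add: family_mult_def functional_sum)
  moreover have "family (family_mult f g) \<in> D"
    using subringE(6)[OF subring_D f(2) g(2)] by (simp add: family_mult)
  ultimately show "\<phi> \<otimes>\<^bsub>C\<^esub> \<psi> \<in> ?K" unfolding f(1) g(1) family_mult by blast
qed

text \<open>A single element with nonzero component in degree \<open>d\<close> is annihilated by
  some nonzero functional. All that is generated then lies in its kernel, although
  \<open>x^2\<close> and \<open>x y^(d p^d)\<close> have values \<alpha> and \<beta>.\<close>

lemma two_generators_per_degree: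
  assumes S: "finite S" "S \<subseteq> D" and d: "d > 0"
    and gen: "family (homog d (varx ^ 2)) \<in> generate_ring C (degree_part D 0 \<union> S)"
      "family (homog d (varx * vary ^ (d * p ^ d))) \<in> generate_ring C (degree_part D 0 \<union> S)"
  shows "2 \<le> card {s \<in> S. s d \<noteq> (\<lambda>_. 0)}"
proof (rule ccontr)
  let ?S = "{s \<in> S. s d \<noteq> (\<lambda>_. 0)}"
  assume "\<not> 2 \<le> card ?S"
  then have "card ?S \<le> Suc 0" by simp
  then have one: "s = t" if "s \<in> ?S" "t \<in> ?S" for s t
    using S(1) that card_le_Suc0_iff_eq[of ?S] by simp
  \<comment> \<open>The coefficient pair of the only relevant element of \<open>S\<close>; it is
    arbitrary if there is none.\<close>
  have "\<exists>a b. \<forall>f. family f \<in> ?S \<longrightarrow> coeff2 (f d) 2 0 = a \<and> coeff2 (f d) 1 (d * p ^ d) = b"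
  proof (cases "\<exists>f. family f \<in> ?S")
    case True
    then obtain f where f: "family f \<in> ?S" by blast
    have "g d = f d" if "family g \<in> ?S" for g
    proof -
      have "family g = family f" using that f by (rule one)
      then have "family g d = family f d" by simp
      then show ?thesis by (simp only: family_eq_iff)
    qed
    then show ?thesis
      by (intro exI[of _ "coeff2 (f d) 2 0"] exI[of _ "coeff2 (f d) 1 (d * p ^ d)"]) simp
  qed blast
  then obtain a b where ab: "\<And>f. family f \<in> ?S \<Longrightarrow>
      coeff2 (f d) 2 0 = a \<and> coeff2 (f d) 1 (d * p ^ d) = b" by blast
  \<comment> \<open>A nonzero vector orthogonal to \<open>(a, b)\<close>: either
    \<open>(b, -a)\<close> or, if \<open>a = b = 0\<close>, \<open>(1, 0)\<close>.\<close>
  obtain \<alpha> \<beta> where nz: "\<alpha> \<noteq> 0 \<or> \<beta> \<noteq> 0" and orth: "\<alpha> * a + \<beta> * b = 0"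
  proof (cases "a = 0 \<and> b = 0")
    case True
    then show thesis by (intro that[of 1 0]) auto
  next
    case False
    then show thesis by (intro that[of b "- a"]) auto
  qed
  let ?K = "{family f | f. family f \<in> D \<and> functional d \<alpha> \<beta> (f d) = 0}"
  have "S \<subseteq> ?K"
  proof
    fix s assume s: "s \<in> S"
    then obtain f where f: "s = family f" using S(2) by (blast elim: D_cases)
    have "functional d \<alpha> \<beta> (f d) = 0"
    proof (cases "f d = 0")
      case False
      then have "family f \<in> ?S" using s f family_eq_zero_iff by auto
      then show ?thesis using ab orth by (simp add: functional_def)
    qed (simp add: functional_zero)
    then show "s \<in> ?K" using s f S(2) by blast
  qed
  moreover have "degree_part D 0 \<subseteq> ?K"
  proof
    fix s assume s: "s \<in> degree_part D 0"
    then have sD: "s \<in> D" "s d = (\<lambda>_. 0)" using d by (auto simp: degree_part_def)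
    from sD(1) obtain f where f: "s = family f" by (blast elim: D_cases)
    then have "f d = 0" using sD(2) family_eq_zero_iff by auto
    then have "functional d \<alpha> \<beta> (f d) = 0" by (simp add: functional_zero)
    then show "s \<in> ?K" using f sD(1) by blast
  qed
  moreover have "degree_part D 0 \<union> S \<subseteq> carrier C"
    using S(2) D_subset_carrier by (auto simp: degree_part_def)
  ultimately have sub: "generate_ring C (degree_part D 0 \<union> S) \<subseteq> ?K"
    by (intro C.generate_ring_min_subring1 subring_functional d) auto
  have "functional d \<alpha> \<beta> h = 0"
    if "family (homog d h) \<in> generate_ring C (degree_part D 0 \<union> S)" for h
  proof -
    obtain f where "family (homog d h) = family f" "functional d \<alpha> \<beta> (f d) = 0"
      using sub \<open>family (homog d h) \<in> _\<close> by blast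
    then show ?thesis using family_eq_iff[of "homog d h" d f] by (simp add: homog_def)
  qed
  from this[OF gen(1)] this[OF gen(2)] nz show False
    by (simp add: functional_varx_square functional_varx_vary d)
qed

section \<open>An explicit generating set\<close>

definition generators :: "nat \<Rightarrow> (nat \<Rightarrow> 'k poly poly \<Rightarrow> 'k poly poly) set" where
  "generators e = (\<Union>d\<in>{1..e}. {family (homog d (varx ^ 2)),
     family (homog d (varx * vary ^ (d * p ^ d)))})"

text \<open>The inequality spares a check that the listed elements are distinct; the lower bound
  comes from \<open>two_generators_per_degree\<close>.\<close>

lemma card_generators: "finite (generators e)" "card (generators e) \<le> 2 * e"
proof -
  show "finite (generators e)" by (auto simp: generators_def)
  have "card (generators e) \<le> (\<Sum>d\<in>{1..e}. card {family (homog d (varx ^ 2)),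
     family (homog d (varx * vary ^ (d * p ^ d)))})"
    unfolding generators_def by (rule card_UN_le) simp
  also have "\<dots> \<le> (\<Sum>d\<in>{1..e}. 2)" by (rule sum_mono) (simp add: card_insert_if)
  finally show "card (generators e) \<le> 2 * e" by simp
qed

lemma generators_cases:
  assumes "\<phi> \<in> generators e"
  obtains d f where "1 \<le> d" "d \<le> e" "\<phi> = family (homog d f)" "f \<in> example_ideal p d"
proof -
  obtain d where "1 \<le> d" "d \<le> e"
    "\<phi> = family (homog d (varx ^ 2)) \<or> \<phi> = family (homog d (varx * vary ^ (d * p ^ d)))"
    using assms by (auto simp: generators_def)
  then show thesis
    using that varx_square_dvd_in_example_ideal[OF dvd_refl] varx_vary_in_example_ideal[of d]
    by fastforce
qed

lemma family_homog_generated: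
  assumes f: "f \<in> example_ideal p d" and d: "d \<le> e"
  shows "family (homog d f) \<in> generate_ring C (degree_part D 0 \<union> generators e)" (is "_ \<in> ?G")
proof -
  have scalar: "scalar r \<in> ?G" for r
    by (rule generate_ring.incl) (simp add: degree_part_D_0)
  show ?thesis
  proof (cases "d = 0")
    case True
    then show ?thesis using scalar by (simp add: family_scalar)
  next
    case False
    then have "d > 0" by simp
    then obtain u v where uv: "f = u * varx ^ 2 + v * (varx * vary ^ (d * p ^ d))"
      using f unfolding example_ideal_iff[OF \<open>d > 0\<close>] varx_square varx_vary_power by blast
    have "d \<in> {1..e}" using False d by simp
    then have "family (homog d (varx ^ 2)) \<in> generators e"
        "family (homog d (varx * vary ^ (d * p ^ d))) \<in> generators e"
      unfolding generators_def by blast+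
    then have gens: "family (homog d (varx ^ 2)) \<in> ?G"
        "family (homog d (varx * vary ^ (d * p ^ d))) \<in> ?G"
      by (blast intro: generate_ring.incl)+
    have "family (homog d (varx ^ 2)) \<otimes>\<^bsub>C\<^esub> scalar u \<oplus>\<^bsub>C\<^esub>
        family (homog d (varx * vary ^ (d * p ^ d))) \<otimes>\<^bsub>C\<^esub> scalar v \<in> ?G"
      by (intro generate_ring.eng_add generate_ring.eng_mult gens scalar)
    moreover have "(\<lambda>e. homog d (varx ^ 2 * u) e + homog d (varx * vary ^ (d * p ^ d) * v) e)
        = homog d f"
      by (auto simp: homog_def uv mult.commute)
    ultimately show ?thesis by (simp only: family_mult_scalar family_add)
  qed
qed

lemma generators_generate:
  "generate_ring C (degree_part D 0 \<union> generators e) = gen_subring p D (int e)" (is "?G = _")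
proof -
  let ?E = "{\<phi> \<in> D. \<forall>d. int d > int e \<longrightarrow> \<phi> d = (\<lambda>_. 0)}"
  have E: "gen_subring p D (int e) = generate_ring C ?E" by (simp add: gen_subring_def)
  have EC: "?E \<subseteq> carrier C" using D_subset_carrier by auto
  have sub: "degree_part D 0 \<union> generators e \<subseteq> ?E"
  proof
    fix \<phi> assume "\<phi> \<in> degree_part D 0 \<union> generators e"
    then show "\<phi> \<in> ?E"
    proof
      assume "\<phi> \<in> generators e"
      then obtain d f where "d \<le> e" "\<phi> = family (homog d f)" "f \<in> example_ideal p d"
        by (rule generators_cases)
      then show ?thesis
        by (auto simp: homog_in_D family_eq_zero_iff) (auto simp: homog_def)
    qed (auto simp: degree_part_def)
  qed
  have "?E \<subseteq> ?G"
  proof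
    fix \<phi> assume \<phi>: "\<phi> \<in> ?E"
    then obtain f where f: "\<phi> = family f" "\<forall>e. f e \<in> example_ideal p e"
      by (blast elim: D_cases)
    have f0: "f d = 0" if "d > e" for d using \<phi> f(1) that by (auto simp: family_eq_zero_iff)
    \<comment> \<open>Rebuilds the element from its homogeneous components, adding one degree at a
      time; \<open>n \<le> Suc e\<close> keeps these degrees at most \<open>e\<close>.\<close>
    have "family (\<lambda>d. if d < n then f d else 0) \<in> ?G" if "n \<le> Suc e" for n
      using that
    proof (induction n)
      case 0
      show ?case using C.zero_in_generate by (simp add: family_zero)
    next
      case (Suc n)
      have "(\<lambda>d. if d < Suc n then f d else 0) =
          (\<lambda>d. (if d < n then f d else 0) + homog n (f n) d)"
        by (auto simp: homog_def less_Suc_eq)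
      then have "family (\<lambda>d. if d < Suc n then f d else 0) =
          family (\<lambda>d. if d < n then f d else 0) \<oplus>\<^bsub>C\<^esub> family (homog n (f n))"
        by (simp only: family_add)
      also have "\<dots> \<in> ?G"
        using Suc f(2) by (intro generate_ring.eng_add family_homog_generated) auto
      finally show ?case .
    qed
    from this[of "Suc e"] have "family (\<lambda>d. if d < Suc e then f d else 0) \<in> ?G" by simp
    moreover have "(\<lambda>d. if d < Suc e then f d else 0) = f" using f0 by auto
    ultimately show "\<phi> \<in> ?G" by (simp only: f(1))
  qed
  moreover have "subring ?G C" using sub EC by (intro C.generate_ring_is_subring) blast
  ultimately have "generate_ring C ?E \<subseteq> ?G" by (intro C.generate_ring_min_subring1 EC)
  moreover have "?G \<subseteq> generate_ring C ?E" using sub EC by (rule C.mono_generate_ring)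
  ultimately show ?thesis by (simp add: E)
qed

section \<open>Minimal numbers of generators and the complexity\<close>

lemma gen_subring_subset_D: "gen_subring p D (int e) \<subseteq> D"
proof -
  have "generate_ring C {\<phi> \<in> D. \<forall>d. int d > int e \<longrightarrow> \<phi> d = (\<lambda>_. 0)} \<subseteq> D"
    using D_subset_carrier by (intro C.generate_ring_min_subring1 subring_D) auto
  then show ?thesis by (simp add: gen_subring_def)
qed

lemma min_gens_D: "min_gens p D (int e) = enat (2 * e)"
proof (rule antisym)
  have "generators e \<subseteq> (\<Union>d. degree_part (gen_subring p D (int e)) d)"
  proof
    fix \<phi> assume \<phi>: "\<phi> \<in> generators e"
    then obtain d f where "\<phi> = family (homog d f)" by (rule generators_cases)
    moreover have "\<phi> \<in> gen_subring p D (int e)"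
      using \<phi> by (auto simp flip: generators_generate intro: generate_ring.incl)
    ultimately have "\<phi> \<in> degree_part (gen_subring p D (int e)) d"
      by (auto simp: degree_part_def family_eq_zero_iff) (simp add: homog_def)
    then show "\<phi> \<in> (\<Union>d. degree_part (gen_subring p D (int e)) d)" by blast
  qed
  then have "min_gens p D (int e) \<le> enat (card (generators e))"
    unfolding min_gens_def using card_generators(1) generators_generate
    by (intro Inf_lower) blast
  also have "\<dots> \<le> enat (2 * e)" using card_generators(2) by simp
  finally show "min_gens p D (int e) \<le> enat (2 * e)" .
  show "enat (2 * e) \<le> min_gens p D (int e)"
    unfolding min_gens_def
  proof (rule Inf_greatest, safe)
    fix S assume S: "finite S" "S \<subseteq> (\<Union>d. degree_part (gen_subring p D (int e)) d)"
      "generate_ring C (degree_part D 0 \<union> S) = gen_subring p D (int e)"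
    let ?S = "\<lambda>d. {s \<in> S. s d \<noteq> (\<lambda>_. 0)}"
    have SD: "S \<subseteq> D" using S(2) gen_subring_subset_D by (auto simp: degree_part_def)
    \<comment> \<open>Elements of \<open>S\<close> are homogeneous, so none counts for two degrees
      and the bounds for the single degrees add up.\<close>
    have disj: "?S c \<inter> ?S d = {}" if "c \<noteq> d" for c d
    proof (rule ccontr)
      assume "?S c \<inter> ?S d \<noteq> {}"
      then obtain s where s: "s \<in> S" "s c \<noteq> (\<lambda>_. 0)" "s d \<noteq> (\<lambda>_. 0)" by blast
      then obtain x where "\<forall>e. e \<noteq> x \<longrightarrow> s e = (\<lambda>_. 0)"
        using S(2) by (auto simp: degree_part_def)
      then show False using s that by metis
    qed
    have "2 \<le> card (?S d)" if "d \<in> {1..e}" for d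
    proof (rule two_generators_per_degree[OF S(1) SD])
      show "d > 0" using that by simp
      show "family (homog d (varx ^ 2)) \<in> generate_ring C (degree_part D 0 \<union> S)"
        "family (homog d (varx * vary ^ (d * p ^ d))) \<in> generate_ring C (degree_part D 0 \<union> S)"
        unfolding S(3) generators_generate[symmetric] using that
        by (auto intro!: family_homog_generated varx_square_dvd_in_example_ideal
            varx_vary_in_example_ideal)
    qed
    then have "(\<Sum>d\<in>{1..e}. 2) \<le> (\<Sum>d\<in>{1..e}. card (?S d))" by (rule sum_mono)
    also have "\<dots> = card (\<Union>d\<in>{1..e}. ?S d)"
      using S(1) disj by (subst card_UN_disjoint) auto
    also have "\<dots> \<le> card S" by (rule card_mono[OF S(1)]) blast
    finally show "enat (2 * e) \<le> enat (card S)" by simp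
  qed
qed

lemma min_gens_D_neg:
  assumes "e < 0"
  shows "min_gens p D e = 0"
proof -
  have D0: "degree_part D 0 \<subseteq> carrier C" using D_subset_carrier by (auto simp: degree_part_def)
  have "generate_ring C (degree_part D 0) = degree_part D 0"
  proof (rule antisym)
    show "generate_ring C (degree_part D 0) \<subseteq> degree_part D 0"
      unfolding degree_part_D_0
      by (intro C.generate_ring_min_subring1 subring_scalars order.refl)
        (use D0 in \<open>simp add: degree_part_D_0\<close>)
    show "degree_part D 0 \<subseteq> generate_ring C (degree_part D 0)" by (auto intro: generate_ring.incl)
  qed
  then have "min_gens p D e \<le> enat (card ({} :: (nat \<Rightarrow> 'k poly poly \<Rightarrow> 'k poly poly) set))"
    unfolding min_gens_def using assms
    by (intro Inf_lower CollectI exI[of _ "{}"]) (simp add: gen_subring_def)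
  then show ?thesis by (simp flip: zero_enat_def)
qed

lemma complexity_D: "complexity p D = 1"
proof -
  let ?g = "\<lambda>e::nat. real (the_enat (min_gens p D (int e)))
      - real (the_enat (min_gens p D (int e - 1)))"
  have fin: "\<forall>e. min_gens p D e \<noteq> \<infinity>"
  proof
    fix e show "min_gens p D e \<noteq> \<infinity>"
      using min_gens_D[of "nat e"] min_gens_D_neg[of e] by (cases "e < 0") auto
  qed
  \<comment> \<open>From degree 1 on each step costs two generators. At \<open>e = 0\<close> both
    \<open>k_0\<close> and \<open>k_(-1)\<close> are 0.\<close>
  have g: "?g e = (if e = 0 then 0 else 2)" for e
  proof (cases e)
    case 0
    then show ?thesis
      using min_gens_D[of 0] min_gens_D_neg[of "-1"] by (simp add: zero_enat_def)
  next
    case (Suc e')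
    then show ?thesis using min_gens_D[of e] min_gens_D[of e'] by simp
  qed
  \<comment> \<open>For \<open>m < 1\<close> the powers of \<open>m\<close> tend to 0 and cannot
    dominate the constant increment 2.\<close>
  have "m \<ge> 1" if "m > 0" and O: "?g \<in> O(\<lambda>e. m ^ e)" for m :: real
  proof (rule ccontr)
    assume "\<not> m \<ge> 1"
    obtain c where "eventually (\<lambda>e. norm (?g e) \<le> c * norm (m ^ e)) at_top"
      using O by (rule landau_o.bigE)
    moreover have "(\<lambda>e. c * norm (m ^ e)) \<longlonglongrightarrow> c * 0"
      using \<open>\<not> m \<ge> 1\<close> \<open>m > 0\<close> by (intro tendsto_mult tendsto_const) (simp add: LIMSEQ_realpow_zero)
    then have "eventually (\<lambda>e. c * norm (m ^ e) < 2) at_top"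
      by (rule order_tendstoD) simp
    moreover have "eventually (\<lambda>e::nat. e > 0) at_top" by (rule eventually_gt_at_top)
    ultimately have "eventually (\<lambda>e::nat. False) at_top"
      by eventually_elim (simp add: g)
    then show False by simp
  qed
  moreover have "?g \<in> O(\<lambda>e. 1 ^ e)"
    unfolding g by (rule bigoI[of _ 2]) simp
  then have "ereal 1 \<in> {ereal m | m. m > 0 \<and> ?g \<in> O(\<lambda>e. m ^ e)}"
    using zero_less_one by blast
  then have "Inf {ereal m | m. m > 0 \<and> ?g \<in> O(\<lambda>e. m ^ e)} \<le> 1"
    unfolding one_ereal_def by (rule Inf_lower)
  ultimately have "Inf {ereal m | m. m > 0 \<and> ?g \<in> O(\<lambda>e. m ^ e)} = 1"
    by (intro antisym Inf_greatest) (auto simp: one_ereal_def)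
  then show ?thesis using fin by (simp add: complexity_def)
qed


subsection \<open>Gauge boundedness\<close>

lemma not_gauge_bounded_D: "\<not> gauge_bounded p D"
proof
  assume "gauge_bounded p D"
  then obtain \<Psi> K where span: "right_span \<Psi> = {\<phi> \<in> D. \<phi> 0 = (\<lambda>_. 0)}"
    and bound: "\<forall>\<psi>\<in>\<Psi>. \<exists>e\<ge>1. \<psi> \<in> degree_part D e \<and>
      (\<forall>r. gauge (\<psi> e r) \<le> gauge r / ereal (real (p ^ e)) + ereal K)"
    unfolding gauge_bounded_def by blast
  \<comment> \<open>The bound \<open>K\<close> would limit all degrees, because some generator in
    degree \<open>e\<close> produces \<open>y^e\<close> from a polynomial of gauge below
    \<open>p^e\<close>.\<close>
  have bounded: "real e \<le> 1 + K" if e: "e > 0" for e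
  proof -
    let ?N = "e * p ^ e" and ?q = "p ^ e"
    have q: "?q \<ge> 2"
      using power_gt_expt[of p e] p_ge_2 e by linarith
    have "family (homog e (varx * vary ^ ?N)) \<in> {\<phi> \<in> D. \<phi> 0 = (\<lambda>_. 0)}"
      using e by (simp add: homog_in_D[OF varx_vary_in_example_ideal[OF e]] family_eq_zero_iff)
        (simp add: homog_def)
    then obtain T c where T: "finite T" "T \<subseteq> \<Psi>"
      "family (homog e (varx * vary ^ ?N)) = (\<lambda>e s. \<Sum>\<psi>\<in>T. \<psi> e (c \<psi> * s))"
      unfolding span[symmetric] right_span_def by blast
    have "\<exists>f. \<psi> = family f \<and> (\<forall>e. f e \<in> example_ideal p e)" if "\<psi> \<in> T" for \<psi>
    proof -
      have "\<psi> \<in> D" using T(2) that bound by (auto simp: degree_part_def)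
      then show ?thesis by (blast elim: D_cases)
    qed
    then obtain F where F: "\<And>\<psi>. \<psi> \<in> T \<Longrightarrow> \<psi> = family (F \<psi>)"
        "\<And>\<psi>. \<psi> \<in> T \<Longrightarrow> F \<psi> e \<in> example_ideal p e" by metis
    have "kap e (varx * vary ^ ?N * r) = kap e ((\<Sum>\<psi>\<in>T. c \<psi> * F \<psi> e) * r)" for r
    proof -
      have "kap e (varx * vary ^ ?N * r) = family (homog e (varx * vary ^ ?N)) e r"
        by (simp add: family_def homog_def)
      also have "\<dots> = (\<Sum>\<psi>\<in>T. family (F \<psi>) e (c \<psi> * r))"
        unfolding T(3) by (rule sum.cong) (use F(1) in metis)+
      also have "\<dots> = kap e ((\<Sum>\<psi>\<in>T. c \<psi> * F \<psi> e) * r)"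
        by (simp add: family_def sum_distrib_right frob_hom_sum[OF kap_hom] mult.assoc
            mult.left_commute[of "F _ e"])
      finally show ?thesis .
    qed
    then have eq: "varx * vary ^ ?N = (\<Sum>\<psi>\<in>T. c \<psi> * F \<psi> e)" by (rule kap_mult_inj)
    \<comment> \<open>With parameters 0 and 1 the functional reads the coefficient of
      \<open>x y^(e p^e)\<close>; being nonzero on the sum, it is nonzero on a summand.\<close>
    have "(\<Sum>\<psi>\<in>T. functional e 0 1 (c \<psi> * F \<psi> e)) \<noteq> 0"
      using functional_varx_vary[OF e, of 0 1] by (simp add: eq functional_sum)
    then obtain \<psi> where \<psi>: "\<psi> \<in> T" "functional e 0 1 (c \<psi> * F \<psi> e) \<noteq> 0"
      by (meson sum.neutral)
    let ?f = "F \<psi> e"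
    have a: "coeff2 ?f 1 ?N \<noteq> 0"
      using \<psi>(2) unfolding functional_mult[OF e F(2)[OF \<psi>(1)]] by (simp add: functional_def)
    obtain e' where e': "\<psi> \<in> degree_part D e'"
        "\<And>r. gauge (\<psi> e' r) \<le> gauge r / ereal (real (p ^ e')) + ereal K"
      using bound \<psi>(1) T(2) by blast
    have "\<psi> e \<noteq> (\<lambda>_. 0)"
      using a F(1)[OF \<psi>(1)] family_eq_zero_iff[of "F \<psi>" e] by auto
    \<comment> \<open>The gauge bound is stated for the degree of \<psi>; its nonzero component in
      degree \<open>e\<close> identifies that degree.\<close>
    then have [simp]: "e' = e" using e'(1) by (auto simp: degree_part_def)
    obtain b where b: "(lam ^^ e) (coeff2 ?f 1 ?N * b) \<noteq> 0"
      using a by (rule funpow_lam_nonzero)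
    \<comment> \<open>Moves \<open>x y^(e q)\<close> to \<open>x^(q-1) y^(e q + q-1)\<close>, from
      which \<open>kap e\<close> makes \<open>y^e\<close>; the factor \<open>b\<close> avoids the
      kernel of the iterate of \<open>lam\<close>.\<close>
    let ?r = "mono2 b (?q - 2) (?q - 1)"
    have "coeff2 (?f * ?r) (0 * ?q + (?q - 1)) (e * ?q + (?q - 1)) = coeff2 ?f 1 ?N * b"
    proof -
      have "?q - 2 \<le> ?q - 1" "?q - 1 \<le> e * ?q + (?q - 1)" "?q - 1 - (?q - 2) = 1"
        "e * ?q + (?q - 1) - (?q - 1) = e * ?q" using q by linarith+
      then show ?thesis by (simp only: coeff2_mult_mono2 mult_zero_left add_0 if_True simp_thms)
    qed
    then have "coeff2 (kap e (?f * ?r)) 0 e \<noteq> 0"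
      using b by (simp only: coeff_kap not_False_eq_True)
    then have "ereal (real e) \<le> gauge (kap e (?f * ?r))" by (rule gauge_ge_coeff2)
    also have "kap e (?f * ?r) = \<psi> e ?r" using F(1)[OF \<psi>(1)] by (metis family_def)
    also have "gauge (\<psi> e ?r) \<le> gauge ?r / ereal (real ?q) + ereal K" using e'(2) by simp
    also have "\<dots> \<le> ereal (real ?q) / ereal (real ?q) + ereal K"
      by (intro add_right_mono ereal_divide_right_mono gauge_mono2_le)
        (use q p_ge_2 in auto)
    also have "\<dots> = ereal (1 + K)" using p_ge_2 by simp
    finally show ?thesis by simp
  qed
  \<comment> \<open>The absolute value forces \<open>e > 0\<close> even for negative
    \<open>K\<close>.\<close>
  obtain e :: nat where "real e > 1 + \<bar>K\<bar>" using reals_Archimedean2 by blast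
  moreover from this have "e > 0" by (cases "e = 0") auto
  ultimately show False using bounded[of e] by linarith
qed

end

section \<open>Passage from a Cartier generator to the example\<close>

lemma cartier_operator_of_generator:
  fixes lam :: "'k::field \<Rightarrow> 'k"
  assumes "prime p" "CHAR('k) = p" "cartier_generator p lam"
  shows "cartier_operator p lam"
proof
  obtain \<Phi> where \<Phi>: "bij_betw \<Phi> (UNIV :: 'k set) (frob_hom p 1)"
    "\<And>a b. \<Phi> (a * b) = (\<lambda>s. \<Phi> a (b * s))" "lam = \<Phi> 1"
    using assms(3) by (auto simp: cartier_generator_def)
  show hom: "lam \<in> frob_hom p 1" using \<Phi>(1,3) bij_betwE by blast
  show "\<exists>c. lam c \<noteq> 0"
  proof (rule ccontr)
    assume "\<nexists>c. lam c \<noteq> 0"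
    \<comment> \<open>Every value of \<Phi> is \<open>lam\<close> precomposed with a scalar, so
      \<open>lam = 0\<close> would make \<Phi> constant and contradict its injectivity.\<close>
    then have "\<Phi> b s = 0" for b s using \<Phi>(2)[of 1 b] \<Phi>(3) by simp
    then have "\<Phi> 0 = \<Phi> 1" by (simp add: fun_eq_iff)
    then show False using \<Phi>(1) by (simp add: bij_betw_def inj_eq)
  qed
qed (use assms in simp_all)

theorem mainTheorem2:
  fixes p :: nat and lam :: "'k::field \<Rightarrow> 'k"
    and D :: "(nat \<Rightarrow> 'k poly poly \<Rightarrow> 'k poly poly) set"
  assumes "prime p" and "CHAR('k) = p" and "F_finite p TYPE('k)"
    and "cartier_generator p lam"
    and "D = ideal_sum_algebra p lam (example_ideal p)"
  shows "cartier_subalgebra p D \<and> \<not> gauge_bounded p D \<and> complexity p D = 1 \<and>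
    (\<exists>D' :: (nat \<Rightarrow> 'k poly poly \<Rightarrow> 'k poly poly) set.
       cartier_subalgebra p D' \<and> complexity p D' < \<infinity> \<and> \<not> gauge_bounded p D')"
proof -
  interpret cartier_operator p lam
    using assms(1,2,4) by (rule cartier_operator_of_generator)
  have "D = cartier_operator.D p lam" by (simp add: assms(5) D_def)
  then have "cartier_subalgebra p D" "\<not> gauge_bounded p D" "complexity p D = 1"
    using cartier_subalgebra_D not_gauge_bounded_D complexity_D by simp_all
  moreover from this have "complexity p D < \<infinity>" by simp
  ultimately show ?thesis by blast
qed

end
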